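(* Let $\mathbf{d}_0\in\mathbb{N}^{n_0}$ and $\mathbf{d}_2\in\mathbb{N}^{n_2}$ be tuples of widths, let $d_3\in\mathbb{N}$, and let $\mathbf{d}=(\mathbf{d}_0,1,\mathbf{d}_2,d_3)$ be the concatenated tuple. Then for any $r$ the neuromanifold $\mathcal{M}_{\mathbf{d},r}$ is equal to $\mathcal{M}_{(\mathbf{d}_0,1,\mathbf{1},d_3),r}$, where $\mathbf{1}=(1,\dots,1)\in\mathbb{N}^{n_2}$. In particular, for $d_3=1$, $\dim(\mathcal{M}_{\mathbf{d},r})=\dim(\mathcal{M}_{(\mathbf{d}_0,1),r})$.
   Context: $\mathrm{Sym}_d(\mathbb{R}^n)$ denotes the real vector space of homogeneous polynomials of degree $d$ in $n$ variables. A polynomial neural network (PNN) with architecture $(\mathbf{d}=(d_0,\dots,d_L),r)$ ($d_i,r$ positive integers) is the map $p_{\mathbf{w}}=W_L\circ\rho_r\circ W_{L-1}\circ\cdots\circ\rho_r\circ W_1:\mathbb{R}^{d_0}\to\mathbb{R}^{d_L}$, where $W_i\in\mathbb{R}^{d_i\times d_{i-1}}$ are linear maps (weights) $\mathbf{w}=(W_1,\dots,W_L)$ and $\rho_r$ raises each coordinate to the $r$-th power. The parameter map is $\Psi_{\mathbf{d},r}:\mathbf{w}\mapsto p_{\mathbf{w}}\in(\mathrm{Sym}_{r^{L-1}}(\mathbb{R}^{d_0}))^{d_L}$. The neuromanifold $\mathcal{M}_{\mathbf{d},r}$ is the image of $\Psi_{\mathbf{d},r}$, a semialgebraic set; $\dim$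 is its dimension as a semialgebraic set, equal to the dimension of its Zariski closure. *)

theory Defs
  imports
    "Jordan_Normal_Form.Matrix"
    "HOL-Library.Poly_Mapping"
    "HOL-Library.Extended_Nat"
    "HOL-Algebra.Generated_Rings"
    "HOL-Algebra.Ideal"
begin

section \<open>Polynomials in the variables \<open>x\<^sub>0, x\<^sub>1, \<dots>\<close>\<close>

text \<open>A monomial is a finitely supported exponent vector; a polynomial is a finitely supported
  family of coefficients, with the convolution product of \<^theory>\<open>HOL-Library.Poly_Mapping\<close>.\<close>

type_synonym mpoly = "(nat \<Rightarrow>\<^sub>0 nat) \<Rightarrow>\<^sub>0 real"

definition Const :: "real \<Rightarrow> mpoly" where
  "Const c = Poly_Mapping.single 0 c"

definition Var :: "nat \<Rightarrow> mpoly" where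
  "Var i = Poly_Mapping.single (Poly_Mapping.single i 1) 1"

definition Sym :: "nat \<Rightarrow> nat \<Rightarrow> mpoly set" where
  "Sym D n = {p. \<forall>m \<in> Poly_Mapping.keys p. Poly_Mapping.keys m \<subseteq> {..<n} \<and> (\<Sum>i<n. Poly_Mapping.lookup m i) = D}"

definition monom_eval :: "nat \<Rightarrow> (nat \<Rightarrow>\<^sub>0 nat) \<Rightarrow> real vec \<Rightarrow> real" where
  "monom_eval n m x = (\<Prod>i<n. (x $ i) ^ Poly_Mapping.lookup m i)"

definition poly_eval :: "nat \<Rightarrow> mpoly \<Rightarrow> real vec \<Rightarrow> real" where
  "poly_eval n p x = (\<Sum>m\<in>Poly_Mapping.keys p. Poly_Mapping.lookup p m * monom_eval n m x)"

section \<open>Polynomial neural networks\<close>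

text \<open>The network is defined over an arbitrary commutative ring: over \<open>real\<close> it is the map
  \<open>p\<^sub>w\<close>, and evaluated at the vector of variables it is \<open>p\<^sub>w\<close> as a tuple of polynomials.
  Weights are listed as \<open>[W\<^sub>1, \<dots>, W\<^sub>L]\<close>, and the last layer has no activation.\<close>

fun network :: "nat \<Rightarrow> 'a :: comm_ring_1 mat list \<Rightarrow> 'a vec \<Rightarrow> 'a vec" where
  "network r [] x = x"
| "network r [W] x = W *\<^sub>v x"
| "network r (W # V # ws) x = network r (V # ws) (map_vec (\<lambda>t. t ^ r) (W *\<^sub>v x))"

definition weights :: "nat list \<Rightarrow> real mat list set" where
  "weights d = {ws. length ws + 1 = length d \<and>
     (\<forall>i < length ws. ws ! i \<in> carrier_mat (d ! (i + 1)) (d ! i))}"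

definition Psi :: "nat list \<Rightarrow> nat \<Rightarrow> real mat list \<Rightarrow> mpoly vec" where
  "Psi d r ws = network r (map (map_mat Const) ws) (vec (hd d) Var)"

definition neuromanifold :: "nat list \<Rightarrow> nat \<Rightarrow> mpoly vec set" where
  "neuromanifold d r = Psi d r ` weights d"

section \<open>Dimension\<close>

definition krull_dim :: "('a, 'b) ring_scheme \<Rightarrow> enat" where
  "krull_dim R = Sup {enat n | n. \<exists>P. (\<forall>i\<le>n. primeideal (P i) R) \<and> (\<forall>i<n. P i \<subset> P (Suc i))}"

definition fun_ring :: "'a set \<Rightarrow> ('a \<Rightarrow> real) ring" where
  "fun_ring A = \<lparr>carrier = extensional A,
     monoid.mult = (\<lambda>f g. \<lambda>x\<in>A. f x * g x), one = (\<lambda>x\<in>A. 1),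
     zero = (\<lambda>x\<in>A. 0), add = (\<lambda>f g. \<lambda>x\<in>A. f x + g x)\<rparr>"

text \<open>For \<open>A \<subseteq> (Sym D n)\<^sup>k\<close> the coordinates on the ambient space are the coefficients of the
  \<open>k\<close> components. This ring is isomorphic to the polynomial ring in these coordinates modulo the
  ideal of the polynomials vanishing on \<open>A\<close>. Coefficients of monomials that do not occur in
  \<open>Sym D n\<close> vanish on \<open>A\<close>, so the ring does not depend on \<open>D\<close> and \<open>n\<close>.\<close>

definition poly_fun_ring :: "nat \<Rightarrow> mpoly vec set \<Rightarrow> (mpoly vec \<Rightarrow> real) ring" where
  "poly_fun_ring k A = (fun_ring A)\<lparr>carrier := generate_ring (fun_ring A)
     ({\<lambda>P\<in>A. c | c. True} \<union> {\<lambda>P\<in>A. Poly_Mapping.lookup (P $ i) m | i m. i < k})\<rparr>"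

text \<open>The dimension of a semialgebraic set \<open>A\<close> is the Krull dimension of its ring of polynomial
  functions (Bochnak, Coste and Roy, Real Algebraic Geometry, Definition 2.8.1). A polynomial
  vanishes on \<open>A\<close> iff it vanishes on the Zariski closure of \<open>A\<close>, so this is also the dimension
  of the Zariski closure.\<close>

definition semialg_dim :: "nat \<Rightarrow> mpoly vec set \<Rightarrow> enat" where
  "semialg_dim k A = krull_dim (poly_fun_ring k A)"

definition neuromanifold_dim :: "nat list \<Rightarrow> nat \<Rightarrow> enat" where
  "neuromanifold_dim d r = semialg_dim (last d) (neuromanifold d r)"

section \<open>Compatibility of the two readings of a network\<close>

lemma poly_eval_superset:
  assumes "finite S" "Poly_Mapping.keys p \<subseteq> S"
  shows "poly_eval n p x = (\<Sum>m\<in>S. Poly_Mapping.lookup p m * monom_eval n m x)"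
  unfolding poly_eval_def
  by (rule sum.mono_neutral_left) (use assms in \<open>auto simp: in_keys_iff\<close>)

lemma poly_eval_add: "poly_eval n (p + q) x = poly_eval n p x + poly_eval n q x"
proof -
  let ?S = "Poly_Mapping.keys p \<union> Poly_Mapping.keys q"
  have "poly_eval n f x = (\<Sum>m\<in>?S. Poly_Mapping.lookup f m * monom_eval n m x)" if "f \<in> {p, q, p + q}" for f
    by (rule poly_eval_superset) (use that keys_add[of p q] in auto)
  then show ?thesis
    by (simp add: lookup_add algebra_simps sum.distrib)
qed

lemma poly_eval_single: "poly_eval n (Poly_Mapping.single m c) x = c * monom_eval n m x"
  by (simp add: poly_eval_def)

lemma monom_eval_add: "monom_eval n (m + m') x = monom_eval n m x * monom_eval n m' x"
  by (simp add: monom_eval_def lookup_add power_add prod.distrib)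

lemma mpoly_single_induct:
  fixes p :: mpoly
  assumes "P 0" and "\<And>m c q. P q \<Longrightarrow> P (Poly_Mapping.single m c + q)"
  shows "P p"
proof (induction p rule: update_induct)
  case const
  then show ?case using assms(1) by simp
next
  case (update f a b)
  have a: "Poly_Mapping.lookup f a = 0"
    using update(1) by (simp add: not_in_keys_iff_lookup_eq_zero)
  have "Poly_Mapping.update a b f = Poly_Mapping.single a b + f"
  proof (rule poly_mapping_eqI)
    fix k
    show "Poly_Mapping.lookup (Poly_Mapping.update a b f) k
        = Poly_Mapping.lookup (Poly_Mapping.single a b + f) k"
      by (cases "k = a") (simp_all add: a lookup_update lookup_add lookup_single_not_eq)
  qed
  then show ?case using assms(2)[OF update(3)] by simp
qed

lemma poly_eval_mult: "poly_eval n (p * q) x = poly_eval n p x * poly_eval n q x"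
proof (induction p rule: mpoly_single_induct)
  case 1
  then show ?case by (simp add: poly_eval_def)
next
  case (2 m c p)
  have "poly_eval n (Poly_Mapping.single m c * q) x = c * monom_eval n m x * poly_eval n q x"
  proof (induction q rule: mpoly_single_induct)
    case 1
    then show ?case by (simp add: poly_eval_def)
  next
    case (2 m' c' q)
    then show ?case
      by (simp add: distrib_left poly_eval_add mult_single poly_eval_single monom_eval_add
          algebra_simps)
  qed
  then show ?case using 2 by (simp add: distrib_right poly_eval_add poly_eval_single)
qed

interpretation poly_eval: comm_ring_hom "\<lambda>p. poly_eval n p x"
proof -
  have "poly_eval n 1 x = 1"
    using poly_eval_single[of n 0 1 x] by (simp add: monom_eval_def)
  moreover have "poly_eval n 0 x = 0" by (simp add: poly_eval_def)
  ultimately show "comm_ring_hom (\<lambda>p. poly_eval n p x)"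
    by unfold_locales (auto simp: poly_eval_add poly_eval_mult)
qed

lemma poly_eval_Const [simp]: "poly_eval n (Const c) x = c"
  by (simp add: Const_def poly_eval_single monom_eval_def)

lemma poly_eval_Var: "i < n \<Longrightarrow> poly_eval n (Var i) x = x $ i"
proof -
  assume "i < n"
  have "(\<Prod>j<n. (x $ j) ^ (if i = j then Suc 0 else 0)) = (\<Prod>j<n. if j = i then x $ j else 1)"
    by (rule prod.cong) auto
  then show ?thesis
    using \<open>i < n\<close> by (simp add: Var_def poly_eval_single monom_eval_def lookup_single when_def)
qed

fun chain_dims :: "nat \<Rightarrow> 'a mat list \<Rightarrow> bool" where
  "chain_dims k [] = True"
| "chain_dims k (W # ws) = (dim_col W = k \<and> chain_dims (dim_row W) ws)"

lemma chain_dims_weights: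
  "ws \<in> weights d \<Longrightarrow> chain_dims (hd d) ws"
proof (induction ws arbitrary: d)
  case (Cons W ws)
  then have len: "length d = length ws + 2"
    and W: "\<And>i. i < Suc (length ws) \<Longrightarrow> (W # ws) ! i \<in> carrier_mat (d ! (i + 1)) (d ! i)"
    unfolding weights_def by auto
  from len obtain a b d' where d: "d = a # b # d'"
    by (metis add_2_eq_Suc' length_Suc_conv)
  have "W \<in> carrier_mat b a" using W[of 0] by (simp add: d)
  moreover have "ws \<in> weights (b # d')"
    using len W[of "Suc _"] by (simp add: d weights_def)
  ultimately show ?case using Cons.IH[of "b # d'"] d by simp
qed simp

lemma network_hom:
  fixes h :: "'a :: comm_ring_1 \<Rightarrow> 'b :: comm_ring_1"
  assumes "comm_ring_hom h" and "chain_dims (dim_vec v) ws"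
  shows "map_vec h (network r ws v) = network r (map (map_mat h) ws) (map_vec h v)"
  using assms(2)
proof (induction r ws v rule: network.induct)
  case (3 r W V ws v)
  interpret comm_ring_hom h by fact
  have *: "map_vec h (W *\<^sub>v v) = map_mat h W *\<^sub>v map_vec h v"
    by (rule mult_mat_vec_hom[of _ "dim_row W" "dim_vec v"]) (use 3(2) in auto)
  have "map_vec h (map_vec (\<lambda>t. t ^ r) (W *\<^sub>v v)) = map_vec (\<lambda>t. t ^ r) (map_vec h (W *\<^sub>v v))"
    by (rule eq_vecI) (auto simp: hom_power)
  then show ?case using 3 * by simp
next
  case (2 r W v)
  interpret comm_ring_hom h by fact
  have "map_vec h (W *\<^sub>v v) = map_mat h W *\<^sub>v map_vec h v"
    by (rule mult_mat_vec_hom[of _ "dim_row W" "dim_vec v"]) (use 2 in auto)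
  then show ?case by simp
qed simp

text \<open>The polynomial tuple \<open>Psi d r ws\<close> represents the map \<open>p\<^sub>w\<close>.\<close>

lemma poly_eval_Psi:
  assumes "ws \<in> weights d" and "x \<in> carrier_vec (hd d)"
  shows "map_vec (\<lambda>p. poly_eval (hd d) p x) (Psi d r ws) = network r ws x"
proof -
  let ?h = "\<lambda>p. poly_eval (hd d) p x"
  have chain: "chain_dims k (map (map_mat f) ws) = chain_dims k ws" for k and f :: "real \<Rightarrow> mpoly"
    by (induction ws arbitrary: k) auto
  have "map_vec ?h (Psi d r ws)
      = network r (map (map_mat ?h) (map (map_mat Const) ws)) (map_vec ?h (vec (hd d) Var))"
    unfolding Psi_def
    by (rule network_hom) (use chain_dims_weights[OF assms(1)] in
        \<open>simp_all add: chain poly_eval.comm_ring_hom_axioms\<close>)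
  also have "map (map_mat ?h) (map (map_mat Const) ws) = ws"
    by (simp add: comp_def map_mat_def) (rule map_idI, auto)
  also have "map_vec ?h (vec (hd d) Var) = x"
    by (rule eq_vecI) (use carrier_vecD[OF assms(2)] in \<open>simp_all add: poly_eval_Var\<close>)
  finally show ?thesis .
qed

lemma Sym_0: "0 \<in> Sym D n" by (simp add: Sym_def)

lemma Sym_add: "p \<in> Sym D n \<Longrightarrow> q \<in> Sym D n \<Longrightarrow> p + q \<in> Sym D n"
  using keys_add[of p q] unfolding Sym_def by blast

lemma Sym_mult:
  assumes "p \<in> Sym D n" "q \<in> Sym E n"
  shows "p * q \<in> Sym (D + E) n"
  unfolding Sym_def
proof (standard, standard)
  fix m assume "m \<in> Poly_Mapping.keys (p * q)"
  then obtain a b where "m = a + b" "a \<in> Poly_Mapping.keys p" "b \<in> Poly_Mapping.keys q"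
    using keys_mult[of p q] by auto
  moreover from this have "Poly_Mapping.keys a \<subseteq> {..<n}" "Poly_Mapping.keys b \<subseteq> {..<n}"
    "(\<Sum>i<n. Poly_Mapping.lookup a i) = D" "(\<Sum>i<n. Poly_Mapping.lookup b i) = E"
    using assms unfolding Sym_def by blast+
  ultimately show "Poly_Mapping.keys m \<subseteq> {..<n} \<and> (\<Sum>i<n. Poly_Mapping.lookup m i) = D + E"
    using keys_add[of a b] by (simp add: lookup_add sum.distrib) blast
qed

lemma Sym_Const: "Const c \<in> Sym 0 n" by (simp add: Sym_def Const_def)

lemma Sym_Var: "i < n \<Longrightarrow> Var i \<in> Sym 1 n"
  by (auto simp: Sym_def Var_def lookup_single when_def)

lemma Sym_power: "p \<in> Sym D n \<Longrightarrow> p ^ r \<in> Sym (D * r) n"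
proof (induction r)
  case 0
  then show ?case using Sym_Const[of 1 n] by (simp add: Const_def)
next
  case (Suc r)
  then show ?case using Sym_mult[of p D n "p ^ r" "D * r"] by simp
qed

lemma Sym_sum: "(\<And>i. i \<in> I \<Longrightarrow> f i \<in> Sym D n) \<Longrightarrow> sum f I \<in> Sym D n"
  by (induction I rule: infinite_finite_induct) (auto simp: Sym_0 Sym_add)

lemma Sym_layer:
  assumes "dim_col W = dim_vec v" "\<And>i. i < dim_vec v \<Longrightarrow> v $ i \<in> Sym D n" "j < dim_row W"
  shows "(map_mat Const W *\<^sub>v v) $ j \<in> Sym D n"
  using assms Sym_mult[OF Sym_Const, of _ D n]
  by (auto simp: scalar_prod_def intro!: Sym_sum)

lemma network_Sym:
  assumes "chain_dims (dim_vec v) ws" "\<And>i. i < dim_vec v \<Longrightarrow> v $ i \<in> Sym D n" "ws \<noteq> []"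
  shows "network r (map (map_mat Const) ws) v \<in> carrier_vec (dim_row (last ws))
    \<and> (\<forall>i < dim_row (last ws). network r (map (map_mat Const) ws) v $ i
         \<in> Sym (D * r ^ (length ws - 1)) n)"
  using assms
proof (induction ws arbitrary: v D rule: induct_list012)
  case (2 W)
  then show ?case using Sym_layer[of W v D n] by (auto intro!: carrier_vecI)
next
  case (3 W V ws)
  let ?u = "map_vec (\<lambda>t. t ^ r) (map_mat Const W *\<^sub>v v)"
  have "\<And>i. i < dim_vec ?u \<Longrightarrow> ?u $ i \<in> Sym (D * r) n"
    using 3(3,4) Sym_power Sym_layer[of W v D n] by auto
  then show ?case using 3(2)[of ?u "D * r"] 3(3) by (simp add: mult.assoc)
qed simp

text \<open>With \<open>L = length d - 1\<close> layers, the entries of \<open>Psi d r ws\<close> are homogeneous of degree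
  \<open>r\<^bsup>L - 1\<^esup>\<close>.\<close>

lemma Psi_Sym:
  assumes "ws \<in> weights d" "length d \<ge> 2"
  shows "Psi d r ws \<in> carrier_vec (last d)"
    and "i < last d \<Longrightarrow> Psi d r ws $ i \<in> Sym (r ^ (length d - 2)) (hd d)"
proof -
  have ne: "ws \<noteq> []" using assms by (auto simp: weights_def)
  have len: "length ws = length d - 1" using assms by (auto simp: weights_def)
  define l where "l = length d - 2"
  have l: "length d = Suc (Suc l)" "length ws = Suc l"
    using assms(2) len by (simp_all add: l_def)
  have "last ws = ws ! l" "last d = d ! (l + 1)"
    using l by (simp_all add: last_conv_nth ne flip: length_greater_0_conv)
  moreover have "ws ! l \<in> carrier_mat (d ! (l + 1)) (d ! l)"
    using assms(1) l by (simp add: weights_def)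
  ultimately have r: "dim_row (last ws) = last d"
    by simp
  have "network r (map (map_mat Const) ws) (vec (hd d) Var) \<in> carrier_vec (last d)
      \<and> (\<forall>i < last d. network r (map (map_mat Const) ws) (vec (hd d) Var) $ i
           \<in> Sym (1 * r ^ (length ws - 1)) (hd d))"
    using network_Sym[of "vec (hd d) Var" ws 1 "hd d" r] chain_dims_weights[OF assms(1)] ne
    by (simp add: r Sym_Var del: One_nat_def)
  then show "Psi d r ws \<in> carrier_vec (last d)"
    and "i < last d \<Longrightarrow> Psi d r ws $ i \<in> Sym (r ^ (length d - 2)) (hd d)"
    unfolding Psi_def by (simp_all add: l)
qed

lemma fun_ring_cring: "cring (fun_ring A)"
proof (rule cringI)
  show "abelian_group (fun_ring A)"
  proof (rule abelian_groupI)
    fix f assume "f \<in> carrier (fun_ring A)"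
    then show "\<exists>g\<in>carrier (fun_ring A). g \<oplus>\<^bsub>fun_ring A\<^esub> f = \<zero>\<^bsub>fun_ring A\<^esub>"
      by (intro bexI[of _ "\<lambda>x\<in>A. - f x"]) (auto simp: fun_ring_def fun_eq_iff)
  qed (auto simp: fun_ring_def fun_eq_iff extensional_def)
  show "Group.comm_monoid (fun_ring A)"
    by (rule comm_monoidI) (auto simp: fun_ring_def fun_eq_iff extensional_def)
qed (auto simp: fun_ring_def fun_eq_iff distrib_right)

lemma poly_fun_ring_cring: "cring (poly_fun_ring k A)"
proof -
  interpret cring "fun_ring A" by (rule fun_ring_cring)
  have H: "{\<lambda>P\<in>A. c | c. True} \<union> {\<lambda>P\<in>A. Poly_Mapping.lookup (P $ i) m | i m. i < k} \<subseteq> carrier (fun_ring A)"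
    by (auto simp: fun_ring_def)
  show ?thesis unfolding poly_fun_ring_def
    by (rule subcring_iff[THEN iffD1])
       (use generate_ring_incl[OF H] generate_ring_is_subring[OF H] in
         \<open>auto intro: subcringI m_comm\<close>)
qed

end

theory Submission
  imports Defs "Jordan_Normal_Form.Char_Poly" "HOL-Library.Function_Algebras"
begin

text \<open>A layer of width one outputs a single form \<open>q\<close>, and by homogeneity the layers behind it can
  only produce \<open>q\<^bsup>R\<^esup> c\<close> with a constant vector \<open>c\<close>, where \<open>R\<close> depends on the depth alone;
  positive widths suffice to reach every \<open>c\<close>. For \<open>d\<^sub>3 = 1\<close> the neuromanifold therefore consists
  of the forms \<open>c q\<^bsup>R\<^esup>\<close>. Its image under \<open>p \<mapsto> p\<^sup>2\<close> is the image of the forms \<open>q\<close> under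
  \<open>p \<mapsto> p\<^bsup>2R\<^esup>\<close>, so it is enough that power maps preserve dimension. By the Dedekind--Mertens
  lemma the coefficients of \<open>p\<close> are integral over those of \<open>p\<^sup>k\<close>, and integral extensions
  preserve the Krull dimension by going up and incomparability.\<close>

section \<open>Subrings of a commutative ring and their prime ideals\<close>

text \<open>The sign of \<open>c\<close> is the obstacle. If R is even and q is nonzero, then
  \<open>c q^R\<close> with c < 0 is not the R-th power of a form, so the neuromanifold behind the
  bottleneck need not be a power image of the one before it; the two are compared through a common
  image instead. Since dimension is defined by chains of primes, a power map has to become a ring
  extension. Functions on a set X are pulled back along a parametrisation of X; the rings of X and
  of its power image then consist of functions of the same parameters, and the map becomes a literal
  inclusion. The coordinates of X are at the same time the coefficients of one generic polynomial
  \<open>f\<close> over the function ring, and those of the power image are the coefficients of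
  \<open>f ^ k\<close>. This is how the Dedekind-Mertens lemma, a statement on single polynomials
  over a commutative ring, comes to bear on a map between sets.\<close>

definition subring_set :: "'a :: comm_ring_1 set \<Rightarrow> bool" where
  "subring_set T \<longleftrightarrow> 1 \<in> T \<and> (\<forall>x\<in>T. \<forall>y\<in>T. x - y \<in> T \<and> x * y \<in> T)"

text \<open>Rings are subsets of a type of class \<open>comm_ring_1\<close>, so that its polynomials
  and determinants are at hand and an extension is an inclusion. \<open>ring_of\<close> leads back
  to the records on which \<open>krull_dim\<close> is defined.\<close>

definition ring_of :: "'a :: comm_ring_1 set \<Rightarrow> 'a ring" where
  "ring_of T = \<lparr>carrier = T, monoid.mult = (*), one = 1, zero = 0, add = (+)\<rparr>"

definition ideal_set :: "'a :: comm_ring_1 set \<Rightarrow> 'a set \<Rightarrow> bool" where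
  "ideal_set T I \<longleftrightarrow> I \<subseteq> T \<and> 0 \<in> I \<and> (\<forall>x\<in>I. \<forall>y\<in>I. x + y \<in> I) \<and> (\<forall>t\<in>T. \<forall>x\<in>I. t * x \<in> I)"

definition prime_set :: "'a :: comm_ring_1 set \<Rightarrow> 'a set \<Rightarrow> bool" where
  "prime_set T P \<longleftrightarrow> ideal_set T P \<and> 1 \<notin> P \<and> (\<forall>x\<in>T. \<forall>y\<in>T. x * y \<in> P \<longrightarrow> x \<in> P \<or> y \<in> P)"

lemma subring_setD:
  assumes "subring_set T"
  shows "1 \<in> T" "0 \<in> T" "x \<in> T \<Longrightarrow> y \<in> T \<Longrightarrow> x - y \<in> T" "x \<in> T \<Longrightarrow> y \<in> T \<Longrightarrow> x * y \<in> T"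
    "x \<in> T \<Longrightarrow> - x \<in> T" "x \<in> T \<Longrightarrow> y \<in> T \<Longrightarrow> x + y \<in> T" "x \<in> T \<Longrightarrow> x ^ n \<in> T"
proof -
  show d: "x - y \<in> T" if "x \<in> T" "y \<in> T" for x y
    using assms that unfolding subring_set_def by blast
  show m: "x * y \<in> T" if "x \<in> T" "y \<in> T" for x y
    using assms that unfolding subring_set_def by blast
  show one: "1 \<in> T" using assms unfolding subring_set_def by blast
  show z: "0 \<in> T" using d[OF one one] by simp
  show n: "- x \<in> T" if "x \<in> T" for x using d[OF z that] by simp
  show "x + y \<in> T" if "x \<in> T" "y \<in> T" for x y using d[OF that(1) n[OF that(2)]] by simp
  show "x ^ n \<in> T" if "x \<in> T" for x by (induction n) (auto simp: one m that)
qed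

lemma subring_set_sum: "subring_set T \<Longrightarrow> (\<And>i. i \<in> A \<Longrightarrow> f i \<in> T) \<Longrightarrow> sum f A \<in> T"
  by (induction A rule: infinite_finite_induct) (auto simp: subring_setD)

lemma subring_set_prod: "subring_set T \<Longrightarrow> (\<And>i. i \<in> A \<Longrightarrow> f i \<in> T) \<Longrightarrow> prod f A \<in> T"
  by (induction A rule: infinite_finite_induct) (auto simp: subring_setD)

lemma ideal_setD:
  assumes "ideal_set T I"
  shows "x \<in> I \<Longrightarrow> x \<in> T" "0 \<in> I" "x \<in> I \<Longrightarrow> y \<in> I \<Longrightarrow> x + y \<in> I"
    "t \<in> T \<Longrightarrow> x \<in> I \<Longrightarrow> t * x \<in> I" "t \<in> T \<Longrightarrow> x \<in> I \<Longrightarrow> x * t \<in> I"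
  using assms unfolding ideal_set_def by (auto simp: mult.commute)

lemma ideal_set_diff:
  assumes "subring_set T" "ideal_set T I" "x \<in> I" "y \<in> I"
  shows "x - y \<in> I"
proof -
  have "-1 \<in> T" using subring_setD[OF assms(1)] by blast
  then have "- 1 * y \<in> I" using ideal_setD(4)[OF assms(2)] assms(4) by blast
  then show ?thesis using ideal_setD(3)[OF assms(2,3)] by fastforce
qed

lemma prime_setD:
  assumes "prime_set T P"
  shows "ideal_set T P" "1 \<notin> P" "x \<in> T \<Longrightarrow> y \<in> T \<Longrightarrow> x * y \<in> P \<Longrightarrow> x \<in> P \<or> y \<in> P"
  using assms unfolding prime_set_def by auto

lemma prime_set_power: 
  assumes "subring_set T" "prime_set T P" "x \<in> T" "x ^ n \<in> P"
  shows "x \<in> P"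
  using assms(4)
proof (induction n)
  case 0
  then show ?case using prime_setD(2)[OF assms(2)] by simp
next
  case (Suc n)
  then show ?case using prime_setD(3)[OF assms(2,3), of "x ^ n"] subring_setD(7)[OF assms(1,3)] by auto
qed

lemma cring_ring_of:
  assumes "subring_set T"
  shows "cring (ring_of T)"
proof (rule cringI)
  show "abelian_group (ring_of T)"
  proof (rule abelian_groupI)
    fix x assume "x \<in> carrier (ring_of T)"
    then show "\<exists>y\<in>carrier (ring_of T). y \<oplus>\<^bsub>ring_of T\<^esub> x = \<zero>\<^bsub>ring_of T\<^esub>"
      by (intro bexI[of _ "- x"]) (auto simp: ring_of_def subring_setD[OF assms])
  qed (auto simp: ring_of_def subring_setD[OF assms] algebra_simps)
  show "Group.comm_monoid (ring_of T)"
    by (rule comm_monoidI) (auto simp: ring_of_def subring_setD[OF assms] algebra_simps)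
qed (auto simp: ring_of_def algebra_simps)

lemma a_inv_ring_of:
  assumes "subring_set T" "x \<in> T"
  shows "\<ominus>\<^bsub>ring_of T\<^esub> x = - x"
proof -
  interpret cring "ring_of T" using cring_ring_of[OF assms(1)] .
  show ?thesis
    by (rule minus_equality) (use assms in \<open>auto simp: ring_of_def subring_setD\<close>)
qed

lemma primeideal_ring_of:
  assumes T: "subring_set T"
  shows "primeideal P (ring_of T) \<longleftrightarrow> prime_set T P"
proof
  assume "primeideal P (ring_of T)"
  then interpret primeideal P "ring_of T" .
  have "P \<subseteq> T" using a_subset by (simp add: ring_of_def)
  moreover have "1 \<notin> P"
    using I_notcarr one_imp_carrier by (force simp: ring_of_def)
  moreover have "0 \<in> P"
    using additive_subgroup.zero_closed[OF is_additive_subgroup] by (simp add: ring_of_def)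
  moreover have "x + y \<in> P" if "x \<in> P" "y \<in> P" for x y
    using additive_subgroup.a_closed[OF is_additive_subgroup that] by (simp add: ring_of_def)
  moreover have "t * x \<in> P" if "t \<in> T" "x \<in> P" for t x
    using I_l_closed[of x t] that by (simp add: ring_of_def)
  moreover have "x \<in> P \<or> y \<in> P" if "x \<in> T" "y \<in> T" "x * y \<in> P" for x y
    using I_prime[of x y] that by (simp add: ring_of_def)
  ultimately show "prime_set T P"
    unfolding prime_set_def ideal_set_def by (intro conjI ballI impI)
next
  assume P: "prime_set T P"
  interpret R: cring "ring_of T" using cring_ring_of[OF T] .
  note ip = ideal_setD[OF prime_setD(1)[OF P]]
  have minus: "- x \<in> P" if "x \<in> P" for x
    using ideal_set_diff[OF T prime_setD(1)[OF P] ip(2) that] by simp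
  show "primeideal P (ring_of T)"
  proof (rule primeidealI)
    show "ideal P (ring_of T)"
    proof (rule idealI[OF R.ring_axioms])
      show "subgroup P (add_monoid (ring_of T))"
      proof (rule R.add.subgroupI)
        show "P \<subseteq> carrier (ring_of T)" using ip(1) by (auto simp: ring_of_def)
        show "P \<noteq> {}" using ip(2) by blast
        show "\<ominus>\<^bsub>ring_of T\<^esub> x \<in> P" if "x \<in> P" for x
          using a_inv_ring_of[OF T ip(1)[OF that]] minus[OF that] by simp
        show "x \<oplus>\<^bsub>ring_of T\<^esub> y \<in> P" if "x \<in> P" "y \<in> P" for x y
          using ip(3)[OF that] by (simp add: ring_of_def)
      qed
    qed (use ip(4,5) in \<open>simp_all add: ring_of_def\<close>)
    show "carrier (ring_of T) \<noteq> P"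
      using prime_setD(2)[OF P] subring_setD(1)[OF T] by (auto simp: ring_of_def)
    show "x \<in> P \<or> y \<in> P" if "x \<in> carrier (ring_of T)" "y \<in> carrier (ring_of T)"
      "x \<otimes>\<^bsub>ring_of T\<^esub> y \<in> P" for x y
      using prime_setD(3)[OF P] that by (simp add: ring_of_def)
  qed (rule R.cring_axioms)
qed

section \<open>Krull dimension along surjective homomorphisms\<close>

lemma primeideal_vimage:
  assumes "ring_hom_cring R S h" "primeideal P S"
  shows "primeideal {x \<in> carrier R. h x \<in> P} R"
proof -
  interpret h: ring_hom_cring R S h by fact
  interpret P: primeideal P S by fact
  let ?Q = "{x \<in> carrier R. h x \<in> P}"
  show ?thesis
  proof (rule primeidealI)
    show "ideal ?Q R"
    proof (rule idealI[OF h.R.ring_axioms])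
      show "subgroup ?Q (add_monoid R)"
      proof (rule h.R.add.subgroupI)
        have "\<zero>\<^bsub>R\<^esub> \<in> ?Q"
          using additive_subgroup.zero_closed[OF P.is_additive_subgroup] by simp
        then show "?Q \<noteq> {}" by (metis empty_iff)
        show "\<ominus>\<^bsub>R\<^esub> x \<in> ?Q" if "x \<in> ?Q" for x
          using that additive_subgroup.a_inv_closed[OF P.is_additive_subgroup] by simp
        show "x \<oplus>\<^bsub>R\<^esub> y \<in> ?Q" if "x \<in> ?Q" "y \<in> ?Q" for x y
          using that additive_subgroup.a_closed[OF P.is_additive_subgroup] by simp
      qed simp
    qed (simp_all add: P.I_l_closed P.I_r_closed)
    show "carrier R \<noteq> ?Q"
    proof
      assume "carrier R = ?Q"
      then have "h \<one>\<^bsub>R\<^esub> \<in> P" using h.R.one_closed by blast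
      then have "\<one>\<^bsub>S\<^esub> \<in> P" by simp
      then show False using P.I_notcarr P.one_imp_carrier by metis
    qed
    show "x \<in> ?Q \<or> y \<in> ?Q" if "x \<in> carrier R" "y \<in> carrier R" "x \<otimes>\<^bsub>R\<^esub> y \<in> ?Q" for x y
      using that P.I_prime[of "h x" "h y"] by simp
  qed (rule h.R.cring_axioms)
qed

text \<open>Primes pull back to primes, and a strict inclusion stays strict because a separating
  element has a preimage. Used in both directions, this transports the dimension along an
  isomorphism.\<close>

lemma krull_dim_surj:
  assumes "ring_hom_cring R S h" "h ` carrier R = carrier S"
  shows "krull_dim S \<le> krull_dim R"
proof -
  have "\<exists>Q. (\<forall>i\<le>n. primeideal (Q i) R) \<and> (\<forall>i<n. Q i \<subset> Q (Suc i))"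
    if prime: "\<forall>i\<le>n. primeideal (P i) S" and chain: "\<forall>i<n. P i \<subset> P (Suc i)" for n P
  proof (intro exI conjI allI impI)
    let ?Q = "\<lambda>i. {x \<in> carrier R. h x \<in> P i}"
    show "primeideal (?Q i) R" if "i \<le> n" for i
      using primeideal_vimage[OF assms(1)] prime that by simp
    show "?Q i \<subset> ?Q (Suc i)" if "i < n" for i
    proof -
      obtain y where y: "y \<in> P (Suc i)" "y \<notin> P i" and sub: "P i \<subseteq> P (Suc i)"
        using chain \<open>i < n\<close> by blast
      have "primeideal (P (Suc i)) S" using prime that by simp
      then have "y \<in> carrier S"
        using y(1) additive_subgroup.a_subset ideal.axioms(1) primeideal.axioms(1) by blast
      then obtain x where "x \<in> carrier R" "y = h x" using assms(2) by blast
      then have "x \<in> ?Q (Suc i)" "x \<notin> ?Q i" using y by simp_all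
      moreover have "?Q i \<subseteq> ?Q (Suc i)" using sub by blast
      ultimately show ?thesis by blast
    qed
  qed
  then have "{enat n |n. \<exists>P. (\<forall>i\<le>n. primeideal (P i) S) \<and> (\<forall>i<n. P i \<subset> P (Suc i))}
    \<subseteq> {enat n |n. \<exists>P. (\<forall>i\<le>n. primeideal (P i) R) \<and> (\<forall>i<n. P i \<subset> P (Suc i))}"
    by (auto 0 3)
  then show ?thesis
    unfolding krull_dim_def by (rule Sup_subset_mono)
qed

section \<open>Integral extensions\<close>

definition integral_over :: "'a :: comm_ring_1 set \<Rightarrow> 'a \<Rightarrow> bool" where
  "integral_over T x \<longleftrightarrow> (\<exists>p. lead_coeff p = 1 \<and> (\<forall>i. coeff p i \<in> T) \<and> poly p x = 0)"

section \<open>Incomparability, going up and chains of primes\<close>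

lemma poly_in_subring:
  assumes "subring_set S" "\<forall>i. coeff p i \<in> S" "x \<in> S"
  shows "poly p x \<in> S"
  using assms(2)
proof (induction p)
  case (pCons a p)
  have "a \<in> S" using pCons(3) by (metis coeff_pCons_0)
  moreover have "\<forall>i. coeff p i \<in> S" using pCons(3) by (metis coeff_pCons_Suc)
  ultimately show ?case using pCons.IH assms(3) by (auto simp: subring_setD[OF assms(1)])
qed (simp add: subring_setD[OF assms(1)])

text \<open>If \<open>t + x * q(x)\<close> lies in \<open>P\<close> and x in \<open>P'\<close>, then
  the constant term t lies in \<open>P' \<inter> T\<close>, hence in \<open>P\<close>. So
  \<open>x * q(x)\<close> is in \<open>P\<close>, and by primality either x is, or q is a shorter
  monic polynomial with value in \<open>P\<close>.\<close>

lemma incomparability: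
  assumes S: "subring_set S" and "T \<subseteq> S" and int: "\<And>x. x \<in> S \<Longrightarrow> integral_over T x"
    and P: "prime_set S P" and P': "ideal_set S P'" and "P \<subseteq> P'" and contr: "P' \<inter> T \<subseteq> P"
  shows "P' \<subseteq> P"
proof
  fix x assume x: "x \<in> P'"
  then have xS: "x \<in> S" using ideal_setD(1)[OF P'] by blast
  \<comment> \<open>The integral equation is only required modulo \<open>P\<close>; in this form it
    survives the removal of the constant term.\<close>
  have "x \<in> P" if "lead_coeff p = 1" "\<forall>i. coeff p i \<in> T" "poly p x \<in> P" for p
    using that
  proof (induction p)
    case 0
    then have "(1::'a) = 0" by simp
    then show ?case using prime_setD(2)[OF P] ideal_setD(2)[OF prime_setD(1)[OF P]] by simp
  next
    case (pCons t q)
    show ?case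
    proof (cases "q = 0")
      case True
      then show ?thesis using pCons.prems prime_setD(2)[OF P] by simp
    next
      case False
      have t: "t \<in> T" and q: "\<forall>i. coeff q i \<in> T"
        using pCons.prems(2) by (metis coeff_pCons_0, metis coeff_pCons_Suc)
      have qS: "poly q x \<in> S" by (rule poly_in_subring[OF S _ xS]) (use q \<open>T \<subseteq> S\<close> in blast)
      have "x * poly q x \<in> P'" using ideal_setD(5)[OF P' qS x] .
      moreover have e: "t + x * poly q x \<in> P" using pCons.prems(3) by simp
      ultimately have "t \<in> P'"
        using ideal_set_diff[OF S P', of "t + x * poly q x" "x * poly q x"] \<open>P \<subseteq> P'\<close> by auto
      then have "t \<in> P" using t contr by blast
      then have "x * poly q x \<in> P"
        using ideal_set_diff[OF S prime_setD(1)[OF P] e \<open>t \<in> P\<close>] by simp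
      then have "x \<in> P \<or> poly q x \<in> P" using prime_setD(3)[OF P xS qS] by blast
      then show ?thesis using pCons.IH pCons.prems(1) q False by auto
    qed
  qed
  then show "x \<in> P" using int[OF xS] ideal_setD(2)[OF prime_setD(1)[OF P]]
    unfolding integral_over_def by metis
qed

text \<open>\<open>max\<close> says that every ideal \<open>P + S x\<close> with x outside
  \<open>P\<close> meets the set \<open>T - p\<close>, which is closed under products as
  \<open>p\<close> is prime. For x, y outside \<open>P\<close> with x y in \<open>P\<close>,
  multiplying two such elements gives one in both \<open>P\<close> and \<open>T - p\<close>.\<close>

lemma prime_set_of_maximal:
  assumes S: "subring_set S" and T: "subring_set T" and "T \<subseteq> S" and p: "prime_set T p"
    and P: "ideal_set S P" and PT: "P \<inter> T \<subseteq> p"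
    and max: "\<And>x. x \<in> S \<Longrightarrow> x \<notin> P \<Longrightarrow> \<exists>a\<in>P. \<exists>s\<in>S. a + s * x \<in> T - p"
  shows "prime_set S P"
  unfolding prime_set_def
proof (intro conjI ballI impI)
  show "ideal_set S P" by fact
  show "1 \<notin> P" using PT subring_setD(1)[OF T] prime_setD(2)[OF p] by blast
  fix x y assume xy: "x \<in> S" "y \<in> S" "x * y \<in> P"
  show "x \<in> P \<or> y \<in> P"
  proof (rule ccontr)
    assume "\<not> (x \<in> P \<or> y \<in> P)"
    then obtain a s b t where a: "a \<in> P" "s \<in> S" "a + s * x \<in> T - p" and b: "b \<in> P" "t \<in> S" "b + t * y \<in> T - p"
      using max xy by metis
    have "(a + s * x) * (b + t * y) = (b + t * y) * a + (s * x) * b + (s * t) * (x * y)"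
      by (simp add: algebra_simps)
    moreover have "(b + t * y) * a \<in> P" "(s * x) * b \<in> P" "(s * t) * (x * y) \<in> P"
      using a b xy subring_setD[OF S] ideal_setD[OF P] by auto
    ultimately have "(a + s * x) * (b + t * y) \<in> P" using ideal_setD(3)[OF P] by metis
    then have "(a + s * x) * (b + t * y) \<in> p" using PT a b subring_setD(4)[OF T] by blast
    then show False using prime_setD(3)[OF p] a b by blast
  qed
qed

text \<open>Zorn's lemma gives an ideal \<open>P\<close> that is maximal among those containing
  \<open>I\<close> and meeting \<open>T\<close> within \<open>p\<close>; integrality is what makes
  the contraction all of \<open>p\<close>. With \<open>I = {0}\<close> this is lying over, with a
  prime \<open>I\<close> it extends a chain.\<close>

lemma going_up:
  assumes S: "subring_set S" and T: "subring_set T" and TS: "T \<subseteq> S"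
    and int: "\<And>x. x \<in> S \<Longrightarrow> integral_over T x"
    and p: "prime_set T p" and I: "ideal_set S I" and IT: "I \<inter> T \<subseteq> p"
  shows "\<exists>P. prime_set S P \<and> I \<subseteq> P \<and> P \<inter> T = p"
proof -
  define \<A> where "\<A> = {J. ideal_set S J \<and> I \<subseteq> J \<and> J \<inter> T \<subseteq> p}"
  have "\<exists>M\<in>\<A>. \<forall>X\<in>\<A>. M \<subseteq> X \<longrightarrow> X = M"
  proof (rule subset_Zorn_nonempty)
    show "\<A> \<noteq> {}" using I IT by (auto simp: \<A>_def)
    fix \<C> assume ne: "\<C> \<noteq> {}" and ch: "subset.chain \<A> \<C>"
    then have sub: "\<And>J. J \<in> \<C> \<Longrightarrow> ideal_set S J \<and> I \<subseteq> J \<and> J \<inter> T \<subseteq> p"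
      unfolding subset.chain_def \<A>_def by blast
    have "ideal_set S (\<Union>\<C>)"
      unfolding ideal_set_def
    proof (intro conjI ballI)
      show "\<Union>\<C> \<subseteq> S" using sub ideal_setD(1) by blast
      show "0 \<in> \<Union>\<C>" using ne sub ideal_setD(2) by blast
      show "t * x \<in> \<Union>\<C>" if "t \<in> S" "x \<in> \<Union>\<C>" for t x
        using that sub ideal_setD(4) by blast
      fix x y assume "x \<in> \<Union>\<C>" "y \<in> \<Union>\<C>"
      then obtain J K where J: "J \<in> \<C>" "x \<in> J" "K \<in> \<C>" "y \<in> K" by blast
      then have "J \<subseteq> K \<or> K \<subseteq> J" using ch unfolding subset.chain_def by blast
      then show "x + y \<in> \<Union>\<C>" using J sub ideal_setD(3) by (metis UnionI subsetD)
    qed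
    then show "\<Union>\<C> \<in> \<A>" using ne sub unfolding \<A>_def by blast
  qed
  then obtain P where "P \<in> \<A>" and max: "\<forall>X\<in>\<A>. P \<subseteq> X \<longrightarrow> X = P" by blast
  then have P: "ideal_set S P" and IP: "I \<subseteq> P" and PT: "P \<inter> T \<subseteq> p"
    unfolding \<A>_def by simp_all
  \<comment> \<open>Otherwise \<open>P + S x\<close>, called \<open>J\<close> below, would be a
    strictly larger member of \<open>\<A>\<close>.\<close>
  have enl: "\<exists>a\<in>P. \<exists>s\<in>S. a + s * x \<in> T - p" if x: "x \<in> S" "x \<notin> P" for x
  proof (rule ccontr)
    assume neg: "\<not> ?thesis"
    define J where "J = {a + s * x | a s. a \<in> P \<and> s \<in> S}"
    have J: "y \<in> J \<longleftrightarrow> (\<exists>a\<in>P. \<exists>s\<in>S. y = a + s * x)" for y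
      unfolding J_def by blast
    have 1: "ideal_set S J"
      unfolding ideal_set_def
    proof (intro conjI ballI)
      show "J \<subseteq> S" using x subring_setD(4,6)[OF S] ideal_setD(1)[OF P] by (auto simp: J)
      show "0 \<in> J" unfolding J
        using ideal_setD(2)[OF P] subring_setD(2)[OF S] by (intro bexI[of _ 0]) simp_all
      show "y + z \<in> J" if y: "y \<in> J" and z: "z \<in> J" for y z
      proof -
        obtain a s b t where "y = a + s * x" "z = b + t * x" "a \<in> P" "s \<in> S" "b \<in> P" "t \<in> S"
          using y z unfolding J by blast
        then have "y + z = (a + b) + (s + t) * x \<and> a + b \<in> P \<and> s + t \<in> S"
          using ideal_setD(3)[OF P] subring_setD(6)[OF S] by (simp add: algebra_simps)
        then show ?thesis unfolding J by blast
      qed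
      show "r * y \<in> J" if r: "r \<in> S" and y: "y \<in> J" for r y
      proof -
        obtain a s where "y = a + s * x" "a \<in> P" "s \<in> S" using y unfolding J by blast
        then have "r * y = r * a + (r * s) * x \<and> r * a \<in> P \<and> r * s \<in> S"
          using ideal_setD(4)[OF P r] subring_setD(4)[OF S] r by (simp add: algebra_simps)
        then show ?thesis unfolding J by blast
      qed
    qed
    have 2: "P \<subseteq> J"
    proof
      fix y assume "y \<in> P"
      then show "y \<in> J" unfolding J
        using subring_setD(2)[OF S] by (intro bexI[of _ y] bexI[of _ 0]) simp_all
    qed
    have 3: "J \<inter> T \<subseteq> p"
    proof
      fix y assume "y \<in> J \<inter> T"
      then obtain a s where "y = a + s * x" "a \<in> P" "s \<in> S" "y \<in> T" unfolding J_def by blast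
      then show "y \<in> p" using neg by fast
    qed
    have "J \<in> \<A>" unfolding \<A>_def using 1 order_trans[OF IP 2] 3 by simp
    then have "J = P" using max 2 by simp
    moreover have "x \<in> J" unfolding J
      using ideal_setD(2)[OF P] subring_setD(1)[OF S] by (intro bexI[of _ 0] bexI[of _ 1]) simp_all
    ultimately show False using x by simp
  qed
  have prime: "prime_set S P"
    by (rule prime_set_of_maximal[OF S T TS p P PT enl])
  \<comment> \<open>For y in \<open>p\<close> outside \<open>P\<close>, maximality yields an element
    \<sigma> = a + x y of \<open>T\<close> outside \<open>p\<close>. The integral equation of x will
    force a power of \<sigma> into \<open>p\<close>.\<close>
  have "p \<subseteq> P"
  proof (rule ccontr)
    assume "\<not> p \<subseteq> P"
    then obtain y where y: "y \<in> p" "y \<notin> P" by blast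
    then have yT: "y \<in> T" using ideal_setD(1)[OF prime_setD(1)[OF p]] by blast
    then have yS: "y \<in> S" using TS by blast
    obtain a x where a: "a \<in> P" and x: "x \<in> S" and \<sigma>: "a + x * y \<in> T - p"
      using enl[OF yS y(2)] by blast
    define \<sigma> where "\<sigma> = a + x * y"
    have \<sigma>T: "\<sigma> \<in> T" "\<sigma> \<notin> p" "\<sigma> \<in> S" using \<sigma> TS by (auto simp: \<sigma>_def)
    note ip = ideal_setD[OF prime_setD(1)[OF p]]
    \<comment> \<open>Multiplying an integral equation of \<open>x\<close> by \<open>y\<^sup>n\<close> yields one for \<open>x y\<close>, which is \<open>\<sigma>\<close>
      modulo \<open>P\<close>, with all lower coefficients in \<open>p\<close>.\<close>
    have "\<exists>u\<in>p. y ^ degree f * poly f x - (lead_coeff f * \<sigma> ^ degree f + u) \<in> P"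
      if "\<forall>i. coeff f i \<in> T" for f
      using that
    proof (induction f)
      case 0
      then show ?case using ip(2) ideal_setD(2)[OF P] by (auto intro!: bexI[of _ 0])
    next
      case (pCons t q)
      show ?case
      proof (cases "q = 0")
        case True
        then show ?thesis using ip(2) ideal_setD(2)[OF P] by (auto intro!: bexI[of _ 0])
      next
        case False
        have t: "t \<in> T" and q: "\<forall>i. coeff q i \<in> T"
          using pCons.prems by (metis coeff_pCons_0, metis coeff_pCons_Suc)
        obtain u where u: "u \<in> p" "y ^ degree q * poly q x - (lead_coeff q * \<sigma> ^ degree q + u) \<in> P"
          using pCons.IH q by blast
        have qS: "poly q x \<in> S" by (rule poly_in_subring[OF S _ x]) (use q TS in blast)
        have "t * y ^ degree q * y + \<sigma> * u \<in> p"
          using u ip y t yT \<sigma>T subring_setD[OF T] by (auto simp: mult.assoc)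
        moreover have "y ^ degree (pCons t q) * poly (pCons t q) x -
            (lead_coeff (pCons t q) * \<sigma> ^ degree (pCons t q) + (t * y ^ degree q * y + \<sigma> * u))
          = \<sigma> * (y ^ degree q * poly q x - (lead_coeff q * \<sigma> ^ degree q + u))
            - a * (y ^ degree q * poly q x)"
          using False by (simp add: \<sigma>_def algebra_simps)
        moreover have "\<sigma> * (y ^ degree q * poly q x - (lead_coeff q * \<sigma> ^ degree q + u))
            - a * (y ^ degree q * poly q x) \<in> P"
        proof (rule ideal_set_diff[OF S P])
          show "\<sigma> * (y ^ degree q * poly q x - (lead_coeff q * \<sigma> ^ degree q + u)) \<in> P"
            by (rule ideal_setD(4)[OF P \<sigma>T(3) u(2)])
          show "a * (y ^ degree q * poly q x) \<in> P"
            by (rule ideal_setD(5)[OF P _ a]) (simp add: subring_setD(4,7)[OF S] qS yS)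
        qed
        ultimately show ?thesis by metis
      qed
    qed
    moreover obtain f where f: "lead_coeff f = 1" "\<forall>i. coeff f i \<in> T" "poly f x = 0"
      using int[OF x] unfolding integral_over_def by blast
    \<comment> \<open>Here f is monic and x is its root, so only the correction terms remain of the
      difference.\<close>
    ultimately obtain u where u: "u \<in> p" "- (\<sigma> ^ degree f + u) \<in> P" by force
    have "- (\<sigma> ^ degree f + u) \<in> T"
      using u ip(1) \<sigma>T subring_setD[OF T] by auto
    then have "- (\<sigma> ^ degree f + u) \<in> p" using u PT by blast
    then have "0 - (- (\<sigma> ^ degree f + u)) - u \<in> p"
      using ideal_set_diff[OF T prime_setD(1)[OF p]] u ip(2) by blast
    then have "\<sigma> ^ degree f \<in> p" by simp
    then show False using prime_set_power[OF T p \<sigma>T(1)] \<sigma>T(2) by blast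
  qed
  then show ?thesis using prime IP PT ideal_setD(1)[OF prime_setD(1)[OF p]] by blast
qed

lemma prime_set_contract:
  assumes "subring_set T" "T \<subseteq> S" "prime_set S P"
  shows "prime_set T (P \<inter> T)"
  using ideal_setD[OF prime_setD(1)[OF assms(3)]] prime_setD[OF assms(3)] subring_setD[OF assms(1)] assms(2)
  unfolding prime_set_def ideal_set_def by (auto simp: subset_iff)

text \<open>The chain is built from the bottom, each prime by going up from the one before. Weak
  inclusions suffice, as strictness can be read off from the contractions.\<close>

lemma prime_chain_lift:
  assumes S: "subring_set S" and T: "subring_set T" and TS: "T \<subseteq> S"
    and int: "\<And>x. x \<in> S \<Longrightarrow> integral_over T x"
    and "\<forall>i\<le>n. prime_set T (P i)" and "\<forall>i<n. P i \<subseteq> P (Suc i)"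
  shows "\<exists>Q. (\<forall>i\<le>n. prime_set S (Q i) \<and> Q i \<inter> T = P i) \<and> (\<forall>i<n. Q i \<subseteq> Q (Suc i))"
  using assms(5,6)
proof (induction n)
  case 0
  have "ideal_set S {0}" using subring_setD[OF S] by (auto simp: ideal_set_def)
  then obtain Q where "prime_set S Q" "Q \<inter> T = P 0"
    using going_up[OF S T TS int, of "P 0" "{0}"] 0 ideal_setD(2)[OF prime_setD(1)] by auto
  then show ?case by (intro exI[of _ "\<lambda>_. Q"]) simp
next
  case (Suc n)
  then obtain Q where Q: "\<forall>i\<le>n. prime_set S (Q i) \<and> Q i \<inter> T = P i" "\<forall>i<n. Q i \<subseteq> Q (Suc i)"
    by auto
  then have "Q n \<inter> T \<subseteq> P (Suc n)" using Suc.prems(2) by auto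
  then obtain R where "prime_set S R" "Q n \<subseteq> R" "R \<inter> T = P (Suc n)"
    using going_up[OF S T TS int, of "P (Suc n)" "Q n"] Q Suc.prems(1) prime_setD(1) by blast
  then show ?case
    using Q by (intro exI[of _ "Q(Suc n := R)"]) (auto simp: le_Suc_eq less_Suc_eq)
qed

proposition krull_dim_integral_extension:
  assumes S: "subring_set S" and T: "subring_set T" and TS: "T \<subseteq> S"
    and int: "\<And>x. x \<in> S \<Longrightarrow> integral_over T x"
  shows "krull_dim (ring_of T) = krull_dim (ring_of S)"
proof -
  have "(\<exists>P. (\<forall>i\<le>n. prime_set T (P i)) \<and> (\<forall>i<n. P i \<subset> P (Suc i)))
    \<longleftrightarrow> (\<exists>P. (\<forall>i\<le>n. prime_set S (P i)) \<and> (\<forall>i<n. P i \<subset> P (Suc i)))" (is "?L \<longleftrightarrow> ?R") for n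
  proof
    assume ?L
    then obtain P where P: "\<forall>i\<le>n. prime_set T (P i)" "\<forall>i<n. P i \<subset> P (Suc i)" by blast
    then obtain Q where Q: "\<forall>i\<le>n. prime_set S (Q i) \<and> Q i \<inter> T = P i" "\<forall>i<n. Q i \<subseteq> Q (Suc i)"
      using prime_chain_lift[OF S T TS int, of n P] by blast
    have "Q i \<subset> Q (Suc i)" if "i < n" for i
    proof -
      have "Q i \<inter> T \<noteq> Q (Suc i) \<inter> T" using Q(1) P(2) that by auto
      then show ?thesis using Q(2) that by blast
    qed
    then show ?R using Q by blast
  next
    assume ?R
    then obtain P where P: "\<forall>i\<le>n. prime_set S (P i)" "\<forall>i<n. P i \<subset> P (Suc i)" by blast
    \<comment> \<open>If the contractions agreed, incomparability would collapse the two primes of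
      \<open>S\<close>.\<close>
    have "P i \<inter> T \<subset> P (Suc i) \<inter> T" if "i < n" for i
    proof -
      have "prime_set S (P (Suc i))" and pr0: "prime_set S (P i)" "P i \<subset> P (Suc i)"
        using P that by (simp_all add: Suc_leI)
      then have pr: "prime_set S (P i)" "ideal_set S (P (Suc i))" "P i \<subset> P (Suc i)"
        by (simp_all add: prime_setD(1))
      then have "\<not> P (Suc i) \<inter> T \<subseteq> P i"
        using incomparability[OF S TS int pr(1,2)] by blast
      then show ?thesis using pr(3) by blast
    qed
    then show ?L using P prime_set_contract[OF T TS]
      by (intro exI[of _ "\<lambda>i. P i \<inter> T"]) blast
  qed
  then show ?thesis
    unfolding krull_dim_def primeideal_ring_of[OF S] primeideal_ring_of[OF T] by simp
qed

section \<open>Finite modules and the determinant trick\<close>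

definition span_over :: "'a :: comm_ring_1 set \<Rightarrow> 'a set \<Rightarrow> 'a set" where
  "span_over T G = {\<Sum>g\<in>G. c g * g | c. \<forall>g. c g \<in> T}"

lemma span_over_add:
  assumes "subring_set T" "x \<in> span_over T G" "y \<in> span_over T G"
  shows "x + y \<in> span_over T G"
proof -
  obtain c d where "x = (\<Sum>g\<in>G. c g * g)" "\<forall>g. c g \<in> T" "y = (\<Sum>g\<in>G. d g * g)" "\<forall>g. d g \<in> T"
    using assms(2,3) unfolding span_over_def by blast
  then have "x + y = (\<Sum>g\<in>G. (c g + d g) * g) \<and> (\<forall>g. c g + d g \<in> T)"
    by (simp add: subring_setD[OF assms(1)] sum.distrib algebra_simps)
  then show ?thesis unfolding span_over_def by (intro CollectI exI[of _ "\<lambda>g. c g + d g"])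
qed

lemma span_over_mult:
  assumes "subring_set T" "x \<in> span_over T G" "t \<in> T"
  shows "t * x \<in> span_over T G"
proof -
  obtain c where "x = (\<Sum>g\<in>G. c g * g)" "\<forall>g. c g \<in> T"
    using assms(2) unfolding span_over_def by blast
  then have "t * x = (\<Sum>g\<in>G. (t * c g) * g) \<and> (\<forall>g. t * c g \<in> T)"
    using assms(3) by (simp add: subring_setD[OF assms(1)] sum_distrib_left algebra_simps)
  then show ?thesis unfolding span_over_def by (intro CollectI exI[of _ "\<lambda>g. t * c g"])
qed

lemma span_over_0: "subring_set T \<Longrightarrow> 0 \<in> span_over T G"
  unfolding span_over_def by (auto intro!: exI[of _ "\<lambda>_. 0"] simp: subring_setD)

lemma span_over_minus: "subring_set T \<Longrightarrow> x \<in> span_over T G \<Longrightarrow> - x \<in> span_over T G"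
  using span_over_mult[of T x G "-1"] subring_setD(1,5)[of T] by auto

lemma span_over_base:
  assumes "subring_set T" "finite G" "g \<in> G"
  shows "g \<in> span_over T G"
proof -
  have "g = (\<Sum>h\<in>G. (if h = g then 1 else 0) * h)"
    using assms by (simp add: if_distrib[of "\<lambda>x. x * _"] sum.delta cong: if_cong)
  then show ?thesis
    unfolding span_over_def using subring_setD[OF assms(1)]
    by (intro CollectI exI[of _ "\<lambda>h. if h = g then 1 else 0"]) auto
qed

lemma span_over_sum:
  "subring_set T \<Longrightarrow> (\<And>i. i \<in> A \<Longrightarrow> f i \<in> span_over T G) \<Longrightarrow> sum f A \<in> span_over T G"
  by (induction A rule: infinite_finite_induct) (auto simp: span_over_0 span_over_add)

lemma span_over_closed:
  assumes "subring_set T" "\<And>g. g \<in> G \<Longrightarrow> x * g \<in> span_over T G" "y \<in> span_over T G"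
  shows "x * y \<in> span_over T G"
proof -
  obtain c where c: "y = (\<Sum>g\<in>G. c g * g)" "\<forall>g. c g \<in> T"
    using assms(3) unfolding span_over_def by blast
  have "x * y = (\<Sum>g\<in>G. c g * (x * g))" by (simp add: c sum_distrib_left algebra_simps)
  also have "\<dots> \<in> span_over T G"
    by (intro span_over_sum span_over_mult assms) (use c in auto)
  finally show ?thesis .
qed

lemma det_in_subring:
  assumes "subring_set T" "A \<in> carrier_mat n n" "\<And>i j. i < n \<Longrightarrow> j < n \<Longrightarrow> A $$ (i, j) \<in> T"
  shows "det A \<in> T"
  unfolding det_def'[OF assms(2)]
proof (intro subring_set_sum[OF assms(1)] subring_setD(4)[OF assms(1)] subring_set_prod[OF assms(1)])
  fix p assume "p \<in> {p. p permutes {0..<n}}"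
  then have p: "p permutes {0..<n}" by simp
  show "signof p \<in> T" by (simp add: sign_def subring_setD[OF assms(1)])
  show "A $$ (i, p i) \<in> T" if "i \<in> {0..<n}" for i
    using assms(3) that permutes_in_image[OF p] by simp
qed

text \<open>Lets \<open>det_in_subring\<close> act inside the polynomial ring, so that the
  characteristic polynomial of a matrix over \<open>T\<close> has its coefficients in
  \<open>T\<close>.\<close>

lemma subring_set_polys:
  assumes "subring_set T"
  shows "subring_set {p. \<forall>i. coeff p i \<in> T}"
  unfolding subring_set_def
  by (auto simp: coeff_mult one_pCons coeff_pCons subring_setD[OF assms] split: nat.split
      intro!: subring_set_sum[OF assms])

text \<open>The determinant trick: multiplication by \<open>x\<close> on a finite module containing \<open>1\<close> is given by a
  matrix over \<open>T\<close>, and \<open>x\<close> is a root of its characteristic polynomial.\<close>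

lemma integral_over_finite_module:
  assumes T: "subring_set T" and "finite G" and one: "1 \<in> span_over T G"
    and closed: "\<And>g. g \<in> G \<Longrightarrow> x * g \<in> span_over T G"
  shows "integral_over T x"
proof -
  obtain gs where gs: "set gs = G" "distinct gs" using finite_distinct_list[OF \<open>finite G\<close>] by blast
  define n where "n = length gs"
  have "\<forall>g\<in>G. \<exists>c. x * g = (\<Sum>h\<in>G. c h * h) \<and> (\<forall>h. c h \<in> T)"
    using closed unfolding span_over_def by blast
  then obtain c where c: "\<And>g. g \<in> G \<Longrightarrow> x * g = (\<Sum>h\<in>G. c g h * h)" "\<And>g h. g \<in> G \<Longrightarrow> c g h \<in> T"
    by metis
  have gi: "gs ! i \<in> G" if "i < n" for i using that gs by (auto simp: n_def)
  define A where "A = mat n n (\<lambda>(i, j). c (gs ! i) (gs ! j))"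
  have A: "A \<in> carrier_mat n n" by (simp add: A_def)
  define v where "v = vec n (\<lambda>i. gs ! i)"
  have v: "v \<in> carrier_vec n" by (simp add: v_def)
  define B where "B = map_mat (\<lambda>p. poly p x) (char_poly_matrix A)"
  have B: "B \<in> carrier_mat n n" using A by (simp add: B_def)
  have Bij: "B $$ (i, j) = (if i = j then x else 0) - c (gs ! i) (gs ! j)" if "i < n" "j < n" for i j
    using that A by (simp add: B_def char_poly_matrix_def) (simp add: A_def)
  \<comment> \<open>\<open>B\<close> is x times the identity minus \<open>A\<close>, and
    \<open>v\<close> lists the generators; row i is the expansion of x times the i-th
    generator.\<close>
  have Bv: "B *\<^sub>v v = 0\<^sub>v n"
  proof (rule eq_vecI)
    fix i assume "i < dim_vec (0\<^sub>v n)"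
    then have i: "i < n" by simp
    have "(B *\<^sub>v v) $ i = (\<Sum>j<n. B $$ (i, j) * gs ! j)"
      using B i by (simp add: scalar_prod_def v_def lessThan_atLeast0)
    also have "\<dots> = (\<Sum>j<n. (if i = j then x * gs ! j else 0) - c (gs ! i) (gs ! j) * gs ! j)"
      by (rule sum.cong) (auto simp: Bij i algebra_simps)
    also have "\<dots> = x * gs ! i - (\<Sum>j<n. c (gs ! i) (gs ! j) * gs ! j)"
      using i by (simp add: sum_subtractf)
    also have "(\<Sum>j<n. c (gs ! i) (gs ! j) * gs ! j) = (\<Sum>h\<in>G. c (gs ! i) h * h)"
      by (rule sum.reindex_bij_betw) (use bij_betw_nth[OF gs(2), of "{..<n}" G] gs in \<open>auto simp: n_def\<close>)
    finally show "(B *\<^sub>v v) $ i = 0\<^sub>v n $ i" using c(1)[OF gi[OF i]] i by simp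
  qed (use B in auto)
  \<comment> \<open>Multiplication by the adjugate turns \<open>B v = 0\<close> into the statement
    that \<open>det B\<close> annihilates every generator.\<close>
  have "det B \<cdot>\<^sub>v v = (det B \<cdot>\<^sub>m 1\<^sub>m n) *\<^sub>v v"
    using v by (intro eq_vecI) (simp_all add: row_smult)
  also have "\<dots> = (adj_mat B * B) *\<^sub>v v" using adj_mat(3)[OF B] by simp
  also have "\<dots> = adj_mat B *\<^sub>v (B *\<^sub>v v)"
    by (rule assoc_mult_mat_vec[OF adj_mat(1)[OF B] B v])
  also have "\<dots> = 0\<^sub>v n"
    unfolding Bv by (rule eq_vecI) (use adj_mat(1)[OF B] in auto)
  finally have dv: "det B * gs ! i = 0" if "i < n" for i
    using that by (metis index_smult_vec(1) index_vec index_zero_vec(1) dim_vec v_def)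
  then have dG: "det B * g = 0" if "g \<in> G" for g
    using that gs by (metis in_set_conv_nth n_def)
  \<comment> \<open>As 1 is a combination of generators, \<open>det B\<close> annihilates 1 and is
    therefore 0.\<close>
  obtain e where "1 = (\<Sum>g\<in>G. e g * g)" using one unfolding span_over_def by blast
  then have "det B = det B * (\<Sum>g\<in>G. e g * g)" by simp
  also have "\<dots> = (\<Sum>g\<in>G. e g * (det B * g))" by (simp add: sum_distrib_left ac_simps)
  also have "\<dots> = 0" using dG by simp
  finally have "det B = 0" .
  moreover have "det B = poly (char_poly A) x"
  proof -
    have "comm_ring_hom (\<lambda>p. poly p x)" by unfold_locales auto
    then show ?thesis unfolding B_def char_poly_def by (rule comm_ring_hom.hom_det)
  qed
  moreover have "lead_coeff (char_poly A) = 1" using degree_monic_char_poly[OF A] by simp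
  moreover have "char_poly A \<in> {p. \<forall>i. coeff p i \<in> T}"
    unfolding char_poly_def
  proof (rule det_in_subring[OF subring_set_polys[OF T] char_poly_matrix_closed[OF A]])
    fix i j assume ij: "i < n" "j < n"
    then show "char_poly_matrix A $$ (i, j) \<in> {p. \<forall>k. coeff p k \<in> T}"
      using c(2)[OF gi[OF ij(1)]] by (auto simp: char_poly_matrix_def A_def coeff_pCons subring_setD[OF T] split: nat.split)
  qed
  ultimately show ?thesis unfolding integral_over_def by auto
qed

section \<open>The Dedekind--Mertens lemma\<close>

text \<open>With \<open>C\<close> the coefficients of a polynomial, these products generate the N-th
  power of its content. Sums are left to the additive subgroups into which the products are shown to
  fall.\<close>

primrec mult_pow :: "'a :: comm_monoid_mult set \<Rightarrow> nat \<Rightarrow> 'a set" where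
  "mult_pow C 0 = {1}"
| "mult_pow C (Suc N) = {c * x | c x. c \<in> C \<and> x \<in> mult_pow C N}"

lemma mult_pow_mono: "C \<subseteq> D \<Longrightarrow> mult_pow C N \<subseteq> mult_pow D N"
  by (induction N) (simp, fastforce)

lemma mult_pow_SucI: "c \<in> C \<Longrightarrow> x \<in> mult_pow C N \<Longrightarrow> c * x \<in> mult_pow C (Suc N)"
  by auto

lemma finite_mult_pow: "finite C \<Longrightarrow> finite (mult_pow C N)"
proof (induction N)
  case (Suc N)
  have "mult_pow C (Suc N) = (\<lambda>(c, x). c * x) ` (C \<times> mult_pow C N)" by auto
  then show ?case using Suc by simp
qed simp

lemma mult_pow_insert:
  assumes "x \<in> mult_pow (insert a C) (Suc N)"
  shows "x \<in> mult_pow C (Suc N) \<or> (\<exists>y\<in>mult_pow (insert a C) N. x = a * y)"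
  using assms
proof (induction N arbitrary: x)
  case (Suc N)
  then obtain c y where x: "x = c * y" "c \<in> insert a C" "y \<in> mult_pow (insert a C) (Suc N)" by auto
  show ?case
  proof (cases "c = a")
    case False
    show ?thesis
    proof (cases "y \<in> mult_pow C (Suc N)")
      case True
      then show ?thesis using x False by auto
    next
      case False
      then obtain z where z: "z \<in> mult_pow (insert a C) N" "y = a * z" using Suc.IH[OF x(3)] by blast
      then have "x = a * (c * z)" using x by (simp add: mult.left_commute)
      then show ?thesis using z(1) x(2) mult_pow_SucI by blast
    qed
  next
    case True
    then show ?thesis using x(1,3) by blast
  qed
qed auto

lemma lookup_single_mult:
  fixes p :: "'m :: cancel_comm_monoid_add \<Rightarrow>\<^sub>0 'a :: comm_ring_1"
  shows "Poly_Mapping.lookup (Poly_Mapping.single b c * p) (b + j) = c * Poly_Mapping.lookup p j"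
  by (simp add: lookup_mult lookup_single when_mult)

lemma lookup_single_mult_cases:
  fixes p :: "'m :: cancel_comm_monoid_add \<Rightarrow>\<^sub>0 'a :: comm_ring_1"
  shows "Poly_Mapping.lookup (Poly_Mapping.single b c * p) k = 0
    \<or> (\<exists>j\<in>Poly_Mapping.keys p. Poly_Mapping.lookup (Poly_Mapping.single b c * p) k = c * Poly_Mapping.lookup p j)"
proof (cases "k \<in> Poly_Mapping.keys (Poly_Mapping.single b c * p)")
  case True
  then obtain j where "j \<in> Poly_Mapping.keys p" "k = b + j"
    using keys_mult[of "Poly_Mapping.single b c" p] by (force split: if_splits)
  then show ?thesis using lookup_single_mult[of b c p j] by auto
qed (simp add: in_keys_iff)

text \<open>With a and b bounding the keys, \<open>l + q = a + b\<close> forces l = a and q = b by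
  strict monotonicity of addition, so a single term of the convolution is left.\<close>

lemma lookup_mult_Max:
  fixes f g :: "'m :: {linorder, cancel_comm_monoid_add, ordered_cancel_comm_monoid_add} \<Rightarrow>\<^sub>0 'a :: comm_ring_1"
  assumes "\<And>m. m \<in> Poly_Mapping.keys f \<Longrightarrow> m \<le> a" "\<And>m. m \<in> Poly_Mapping.keys g \<Longrightarrow> m \<le> b"
  shows "Poly_Mapping.lookup (f * g) (a + b) = Poly_Mapping.lookup f a * Poly_Mapping.lookup g b"
proof -
  have "Poly_Mapping.lookup f l * (\<Sum>q. Poly_Mapping.lookup g q when a + b = l + q)
      = (Poly_Mapping.lookup f l * Poly_Mapping.lookup g b when l = a)" for l
  proof (cases "l \<in> Poly_Mapping.keys f")
    case True
    show ?thesis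
    proof (cases "l = a")
      case False
      with True have "l < a" using assms(1) by fastforce
      have "(Poly_Mapping.lookup g q when a + b = l + q) = 0" for q
      proof (rule ccontr)
        assume "(Poly_Mapping.lookup g q when a + b = l + q) \<noteq> 0"
        then have "q \<in> Poly_Mapping.keys g" "a + b = l + q" by (auto simp: in_keys_iff when_def split: if_splits)
        then show False using assms(2)[of q] add_less_le_mono[OF \<open>l < a\<close>] by fastforce
      qed
      then show ?thesis using False by simp
    qed simp
  qed (simp add: in_keys_iff)
  then show ?thesis by (simp add: lookup_mult)
qed

text \<open>The target \<open>H\<close> of the content inclusion is kept this general because the
  induction replaces it by \<open>{z. fa * z \<in> H}\<close>, while the application takes a module
  over a subring.\<close>

definition add_subgroup_set :: "'a :: ab_group_add set \<Rightarrow> bool" where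
  "add_subgroup_set H \<longleftrightarrow> 0 \<in> H \<and> (\<forall>x\<in>H. \<forall>y\<in>H. x - y \<in> H)"

lemma add_subgroup_setD:
  assumes "add_subgroup_set H"
  shows "0 \<in> H" "x \<in> H \<Longrightarrow> y \<in> H \<Longrightarrow> x - y \<in> H" "x \<in> H \<Longrightarrow> y \<in> H \<Longrightarrow> x + y \<in> H"
proof -
  show d: "x - y \<in> H" if "x \<in> H" "y \<in> H" for x y
    using assms that unfolding add_subgroup_set_def by blast
  show "0 \<in> H" using assms unfolding add_subgroup_set_def by blast
  then show "x + y \<in> H" if "x \<in> H" "y \<in> H" for x y
    using d[OF that(1) d[OF _ that(2)], of 0] by simp
qed

abbreviation coeffs_of :: "('m \<Rightarrow>\<^sub>0 'a :: zero) \<Rightarrow> 'a set" where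
  "coeffs_of f \<equiv> Poly_Mapping.lookup f ` Poly_Mapping.keys f"

text \<open>In terms of contents: \<open>c(f)\<^bsup>N\<^esup> c(g) \<subseteq> c(f)\<^bsup>N-1\<^esup> c(f g)\<close> if \<open>g\<close> has at most \<open>N\<close> terms.
  Products containing the leading coefficient of \<open>f\<close> are treated by removing the leading term of
  \<open>g\<close>, the others by removing the leading term of \<open>f\<close>. For \<open>N = 0\<close> the truncated subtraction is
  harmless, as then \<open>g = 0\<close>.\<close>

lemma dedekind_mertens:
  fixes f g :: "'m :: {linorder, cancel_comm_monoid_add, ordered_cancel_comm_monoid_add} \<Rightarrow>\<^sub>0 'a :: comm_ring_1"
  assumes "add_subgroup_set H" and "card (Poly_Mapping.keys g) \<le> N"
    and "\<And>x m. x \<in> mult_pow (coeffs_of f) (N - 1) \<Longrightarrow> x * Poly_Mapping.lookup (f * g) m \<in> H"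
    and "x \<in> mult_pow (coeffs_of f) N"
  shows "x * Poly_Mapping.lookup g m \<in> H"
  using assms
proof (induction "card (Poly_Mapping.keys g) + card (Poly_Mapping.keys f)"
    arbitrary: f g H N x m rule: less_induct)
  case less
  note H = add_subgroup_setD[OF less.prems(1)]
  show ?case
  proof (cases "f = 0 \<or> g = 0")
    case True
    show ?thesis
    proof (cases "g = 0")
      case True
      then show ?thesis using H(1) by simp
    next
      case False
      \<comment> \<open>Here f = 0 has no coefficients, so there are no products of N > 0 of
        them.\<close>
      then have "N > 0" using less.prems(2) by (cases N) auto
      then show ?thesis using True False less.prems(4) by (cases N) auto
    qed
  next
    case False
    then have ne: "Poly_Mapping.keys f \<noteq> {}" "Poly_Mapping.keys g \<noteq> {}" by auto
    define a where "a = Max (Poly_Mapping.keys f)"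
    define b where "b = Max (Poly_Mapping.keys g)"
    define fa where "fa = Poly_Mapping.lookup f a"
    define gb where "gb = Poly_Mapping.lookup g b"
    have ab: "a \<in> Poly_Mapping.keys f" "b \<in> Poly_Mapping.keys g" using ne by (simp_all add: a_def b_def)
    have faC: "fa \<in> coeffs_of f" using ab by (simp add: fa_def)
    define f' where "f' = f - Poly_Mapping.single a fa"
    define g' where "g' = g - Poly_Mapping.single b gb"
    have lf': "Poly_Mapping.lookup f' k = (if k = a then 0 else Poly_Mapping.lookup f k)" for k
      by (simp add: f'_def lookup_minus lookup_single fa_def when_def)
    have lg': "Poly_Mapping.lookup g' k = (if k = b then 0 else Poly_Mapping.lookup g k)" for k
      by (simp add: g'_def lookup_minus lookup_single gb_def when_def)
    have kf': "Poly_Mapping.keys f' = Poly_Mapping.keys f - {a}"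
      and kg': "Poly_Mapping.keys g' = Poly_Mapping.keys g - {b}"
      by (auto simp: in_keys_iff lf' lg' split: if_splits)
    have cf': "card (Poly_Mapping.keys f') < card (Poly_Mapping.keys f)"
      and cg': "card (Poly_Mapping.keys g') < card (Poly_Mapping.keys g)"
      unfolding kf' kg' by (rule card_Diff1_less; use ab in simp)+
    have Cf': "coeffs_of f' \<subseteq> coeffs_of f" by (auto simp: kf' lf')
    have Cf: "coeffs_of f = insert fa (coeffs_of f')"
      using ab by (auto simp: kf' lf' fa_def)
    obtain M where N: "N = Suc M" using less.prems(2) cg' by (cases N) auto
    have hyp: "y * Poly_Mapping.lookup (f * g) k \<in> H" if "y \<in> mult_pow (coeffs_of f) M" for y k
      using less.prems(3) that by (simp add: N)
    have lead: "Poly_Mapping.lookup (f * g) (a + b) = fa * gb"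
      unfolding fa_def gb_def by (rule lookup_mult_Max) (simp_all add: a_def b_def)
    \<comment> \<open>Products with the factor \<open>fa\<close>. At the leading exponent of g the
      claim is about the leading coefficient \<open>fa * gb\<close> of \<open>f * g\<close>; at the
      others g may be replaced by \<open>g'\<close>.\<close>
    have top: "fa * y * Poly_Mapping.lookup g k \<in> H" if y: "y \<in> mult_pow (coeffs_of f) M" for y k
    proof (cases "k = b")
      case True
      have "fa * y * Poly_Mapping.lookup g k = y * Poly_Mapping.lookup (f * g) (a + b)"
        unfolding lead True gb_def by (simp add: ac_simps)
      then show ?thesis using hyp[OF y] by simp
    next
      case False
      show ?thesis
      proof (cases "k \<in> Poly_Mapping.keys g")
        case k: True
        then have "card (Poly_Mapping.keys g') > 0" using False by (auto simp: kg' card_gt_0_iff)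
        \<comment> \<open>A second key of g besides b makes M positive, so \<open>M - 1\<close> is a
          genuine predecessor.\<close>
        then obtain M' where M: "M = Suc M'" using cg' less.prems(2) N by (cases M) auto
        \<comment> \<open>The spare factor \<open>fa\<close> is moved into the target, which leaves
          products of M coefficients for the induction hypothesis.\<close>
        define H' where "H' = {z. fa * z \<in> H}"
        have "add_subgroup_set H'"
          using H by (auto simp: H'_def add_subgroup_set_def right_diff_distrib)
        moreover have "z * Poly_Mapping.lookup (f * g') j \<in> H'" if z: "z \<in> mult_pow (coeffs_of f) (M - 1)" for z j
        proof -
          have z': "z \<in> mult_pow (coeffs_of f) M'" using z by (simp add: M)
          have "f * g' = f * g - Poly_Mapping.single b gb * f"
            by (simp add: g'_def right_diff_distrib mult.commute)
          then have e: "fa * (z * Poly_Mapping.lookup (f * g') j)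
            = fa * z * Poly_Mapping.lookup (f * g) j - fa * z * Poly_Mapping.lookup (Poly_Mapping.single b gb * f) j"
            by (simp only: lookup_minus right_diff_distrib mult.assoc)
          have 1: "fa * z * Poly_Mapping.lookup (f * g) j \<in> H"
            by (rule hyp) (use faC z' in \<open>auto simp: M\<close>)
          \<comment> \<open>Exchange of factors: a coefficient c of f turns
            \<open>fa * z * (gb * c)\<close> into \<open>(c * z) * (fa * gb)\<close>, and
            \<open>fa * gb\<close> is a coefficient of \<open>f * g\<close>.\<close>
          have 2: "fa * z * Poly_Mapping.lookup (Poly_Mapping.single b gb * f) j \<in> H"
            using lookup_single_mult_cases[of b gb f j]
          proof (elim disjE bexE)
            fix i assume i: "i \<in> Poly_Mapping.keys f"
              and "Poly_Mapping.lookup (Poly_Mapping.single b gb * f) j = gb * Poly_Mapping.lookup f i"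
            then have "fa * z * Poly_Mapping.lookup (Poly_Mapping.single b gb * f) j
              = (Poly_Mapping.lookup f i * z) * Poly_Mapping.lookup (f * g) (a + b)"
              by (simp add: lead ac_simps)
            moreover have "Poly_Mapping.lookup f i * z \<in> mult_pow (coeffs_of f) M"
              using i z' by (auto simp: M)
            ultimately show ?thesis using hyp by simp
          qed (use H in simp)
          show ?thesis unfolding H'_def mem_Collect_eq e by (rule H(2)[OF 1 2])
        qed
        ultimately have "y * Poly_Mapping.lookup g' k \<in> H'"
          using less.hyps[of g' f H' M y k] cg' less.prems(2) y by (simp add: N)
        then show ?thesis using False by (simp add: H'_def lg' mult.assoc)
      qed (simp add: in_keys_iff H)
    qed
    have "x \<in> mult_pow (coeffs_of f') N \<or> (\<exists>y\<in>mult_pow (coeffs_of f) M. x = fa * y)"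
      using mult_pow_insert[of x fa "coeffs_of f'" M] less.prems(4) Cf by (simp only: N)
    then show ?thesis
    proof
      assume x: "x \<in> mult_pow (coeffs_of f') N"
      \<comment> \<open>The products of \<open>f' * g\<close> and \<open>f * g\<close> differ by
        \<open>fa\<close> times coefficients of g, which \<open>top\<close> has already placed in
        \<open>H\<close>.\<close>
      have "y * Poly_Mapping.lookup (f' * g) k \<in> H" if "y \<in> mult_pow (coeffs_of f') (N - 1)" for y k
      proof -
        have y: "y \<in> mult_pow (coeffs_of f) M" using that mult_pow_mono[OF Cf'] N by auto
        have "f' * g = f * g - Poly_Mapping.single a fa * g" by (simp add: f'_def left_diff_distrib)
        then have e: "y * Poly_Mapping.lookup (f' * g) k
          = y * Poly_Mapping.lookup (f * g) k - y * Poly_Mapping.lookup (Poly_Mapping.single a fa * g) k"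
          by (simp only: lookup_minus right_diff_distrib)
        have 2: "y * Poly_Mapping.lookup (Poly_Mapping.single a fa * g) k \<in> H"
          using lookup_single_mult_cases[of a fa g k]
        proof (elim disjE bexE)
          fix i assume "Poly_Mapping.lookup (Poly_Mapping.single a fa * g) k = fa * Poly_Mapping.lookup g i"
          then show ?thesis using top[OF y, of i] by (simp add: ac_simps)
        qed (use H in simp)
        show ?thesis unfolding e by (rule H(2)[OF hyp[OF y] 2])
      qed
      then show ?thesis
        using less.hyps[of g f' H N x m] cf' less.prems(1,2) x by simp
    qed (use top in auto)
  qed
qed

text \<open>Descent from \<open>f ^ k\<close> to \<open>f ^ 0 = 1\<close>: each use of
  Dedekind-Mertens lowers the power of f by one at the price of one more factor. N is chosen before
  H because the module used for H later is itself built from N.\<close>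

lemma mult_pow_content_power:
  fixes f :: "'m :: {linorder, cancel_comm_monoid_add, ordered_cancel_comm_monoid_add} \<Rightarrow>\<^sub>0 'a :: comm_ring_1"
  shows "\<exists>N. \<forall>H. add_subgroup_set H
    \<longrightarrow> (\<forall>x\<in>mult_pow (coeffs_of f) N. \<forall>m. x * Poly_Mapping.lookup (f ^ k) m \<in> H)
    \<longrightarrow> mult_pow (coeffs_of f) (N + k) \<subseteq> H"
proof -
  define g where "g j = f ^ j" for j
  have g: "g 0 = 1" "\<And>j. g (Suc j) = f * g j" by (simp_all only: g_def power_0 power_Suc)
  define t where "t j = card (Poly_Mapping.keys (g j))" for j
  \<comment> \<open>Some common bound for the number of terms of \<open>f ^ j\<close>, j < k; the
    sum is one.\<close>
  define N where "N = (\<Sum>j<k. t j)"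
  have N: "t j \<le> N" if "j < k" for j
    unfolding N_def using that member_le_sum[of j "{..<k}" t] by simp
  have "mult_pow (coeffs_of f) (N + k) \<subseteq> H"
    if H: "add_subgroup_set H" and hyp: "\<forall>x\<in>mult_pow (coeffs_of f) N. \<forall>m. x * Poly_Mapping.lookup (g k) m \<in> H" for H
  proof
    have *: "x * Poly_Mapping.lookup (g (k - i)) m \<in> H"
      if "i \<le> k" "x \<in> mult_pow (coeffs_of f) (N + i)" for i x m
      using that
    proof (induction i arbitrary: x m)
      case 0
      then show ?case using hyp by simp
    next
      case (Suc i)
      have "k - i = Suc (k - Suc i)" using Suc.prems(1) by simp
      then have e: "f * g (k - Suc i) = g (k - i)" using g(2) by metis
      show ?case
      proof (rule dedekind_mertens[OF H])
        show "card (Poly_Mapping.keys (g (k - Suc i))) \<le> N + Suc i"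
          using N[of "k - Suc i"] Suc.prems(1) unfolding t_def by linarith
        show "y * Poly_Mapping.lookup (f * g (k - Suc i)) j \<in> H"
          if "y \<in> mult_pow (coeffs_of f) (N + Suc i - 1)" for y j
          unfolding e using Suc.IH Suc.prems(1) that by simp
      qed (rule Suc.prems(2))
    qed
    show "x \<in> H" if "x \<in> mult_pow (coeffs_of f) (N + k)" for x
      using *[OF order_refl that, of 0] by (simp add: g(1) lookup_one)
  qed
  then show ?thesis unfolding g_def by blast
qed

text \<open>\<open>gen\<close> says that x lies in the ring generated by \<open>T\<close> and the
  coefficients of f. The products of fewer than N + k coefficients span a finite T-module that is
  stable under further coefficients, since products of length N + k fall back into it. Then x is
  integral by the determinant trick.\<close>

lemma integral_over_power_coeffs:
  fixes f :: "'m :: {linorder, cancel_comm_monoid_add, ordered_cancel_comm_monoid_add} \<Rightarrow>\<^sub>0 'a :: comm_ring_1"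
  assumes T: "subring_set T" and "k > 0" and coeffs: "\<And>m. Poly_Mapping.lookup (f ^ k) m \<in> T"
    and gen: "\<And>H. subring_set H \<Longrightarrow> T \<subseteq> H \<Longrightarrow> coeffs_of f \<subseteq> H \<Longrightarrow> x \<in> H"
  shows "integral_over T x"
proof -
  let ?C = "coeffs_of f"
  obtain N where N: "\<forall>H. add_subgroup_set H
      \<longrightarrow> (\<forall>x\<in>mult_pow ?C N. \<forall>m. x * Poly_Mapping.lookup (f ^ k) m \<in> H)
      \<longrightarrow> mult_pow ?C (N + k) \<subseteq> H"
    using mult_pow_content_power[of f k] ..
  define G where "G = (\<Union>j<N + k. mult_pow ?C j)"
  have fin: "finite G" by (simp add: G_def finite_mult_pow)
  let ?M = "span_over T G"
  have base: "y \<in> ?M" if "y \<in> mult_pow ?C j" "j < N + k" for y j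
    using that by (intro span_over_base[OF T fin]) (auto simp: G_def)
  have "add_subgroup_set ?M"
    using span_over_0[OF T, of G] span_over_add[OF T, of _ G] span_over_minus[OF T, of _ G]
    unfolding add_subgroup_set_def by (metis diff_conv_add_uminus)
  then have top: "mult_pow ?C (N + k) \<subseteq> ?M"
  proof (rule N[rule_format])
    fix y m assume "y \<in> mult_pow ?C N"
    then have "Poly_Mapping.lookup (f ^ k) m * y \<in> ?M"
      using base[of y N] coeffs \<open>k > 0\<close> by (intro span_over_mult[OF T]) simp_all
    then show "y * Poly_Mapping.lookup (f ^ k) m \<in> ?M" by (simp only: mult.commute)
  qed
  have C: "c * g \<in> ?M" if c: "c \<in> ?C" and g: "g \<in> G" for c g
  proof -
    obtain j where j: "j < N + k" "g \<in> mult_pow ?C j" using g unfolding G_def by blast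
    then have cg: "c * g \<in> mult_pow ?C (Suc j)" using c mult_pow_SucI by blast
    show ?thesis
    proof (cases "Suc j < N + k")
      case True
      then show ?thesis using base cg by blast
    next
      case False
      then have "Suc j = N + k" using j by simp
      then show ?thesis using top cg by auto
    qed
  qed
  \<comment> \<open>The multiplier ring of the module; \<open>gen\<close> applies to it.\<close>
  define H where "H = {x. \<forall>y\<in>?M. x * y \<in> ?M}"
  have "x \<in> H"
  proof (rule gen)
    show "subring_set H"
      unfolding subring_set_def
    proof (intro conjI ballI)
      fix x y assume "x \<in> H" "y \<in> H"
      then have xy: "x * z \<in> ?M" "y * z \<in> ?M" if "z \<in> ?M" for z
        using that by (simp_all add: H_def)
      show "x * y \<in> H" using xy by (simp add: H_def mult.assoc)
      have "x * z - y * z \<in> ?M" if "z \<in> ?M" for z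
        using span_over_add[OF T xy(1)[OF that] span_over_minus[OF T xy(2)[OF that]]] by simp
      then show "x - y \<in> H" by (simp add: H_def left_diff_distrib)
    qed (simp add: H_def)
    show "T \<subseteq> H" using span_over_mult[OF T, of _ G] by (auto simp: H_def)
    show "?C \<subseteq> H" unfolding H_def using span_over_closed[OF T C] by blast
  qed
  have "1 \<in> ?M" using base[of 1 0] \<open>k > 0\<close> by simp
  moreover have "x * g \<in> ?M" if "g \<in> G" for g
    using \<open>x \<in> H\<close> span_over_base[OF T fin that] by (simp add: H_def)
  ultimately show ?thesis by (rule integral_over_finite_module[OF T fin])
qed

section \<open>Coefficients of products, in a subring and at a parameter\<close>

lemma lookup_mult_sum:
  fixes f g :: "'m :: cancel_comm_monoid_add \<Rightarrow>\<^sub>0 'a :: comm_ring_1"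
  assumes A: "finite A" "Poly_Mapping.keys f \<subseteq> A" and B: "finite B" "Poly_Mapping.keys g \<subseteq> B"
  shows "Poly_Mapping.lookup (f * g) m
    = (\<Sum>a\<in>A. \<Sum>b\<in>B. if a + b = m then Poly_Mapping.lookup f a * Poly_Mapping.lookup g b else 0)"
proof -
  have expand: "p = (\<Sum>a\<in>D. Poly_Mapping.single a (Poly_Mapping.lookup p a))"
    if "finite D" "Poly_Mapping.keys p \<subseteq> D" for p :: "'m \<Rightarrow>\<^sub>0 'a" and D
  proof (rule poly_mapping_eqI)
    fix k
    show "Poly_Mapping.lookup p k = Poly_Mapping.lookup (\<Sum>a\<in>D. Poly_Mapping.single a (Poly_Mapping.lookup p a)) k"
      using that by (auto simp: lookup_sum lookup_single when_def in_keys_iff sum.delta)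
  qed
  have "f * g = (\<Sum>a\<in>A. \<Sum>b\<in>B. Poly_Mapping.single (a + b) (Poly_Mapping.lookup f a * Poly_Mapping.lookup g b))"
    by (subst expand[OF A], subst expand[OF B]) (simp add: sum_product mult_single)
  then show ?thesis by (simp add: lookup_sum lookup_single when_def)
qed

lemma coeffs_mult_in_subring:
  fixes f g :: "'m :: cancel_comm_monoid_add \<Rightarrow>\<^sub>0 'a :: comm_ring_1"
  assumes S: "subring_set S" and "\<And>m. Poly_Mapping.lookup f m \<in> S" "\<And>m. Poly_Mapping.lookup g m \<in> S"
  shows "Poly_Mapping.lookup (f * g) m \<in> S"
  unfolding lookup_mult_sum[OF finite_keys order_refl finite_keys order_refl]
  by (intro subring_set_sum[OF S]) (simp add: subring_setD[OF S] assms)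

lemma coeffs_power_in_subring:
  fixes f :: "'m :: cancel_comm_monoid_add \<Rightarrow>\<^sub>0 'a :: comm_ring_1"
  assumes S: "subring_set S" and "\<And>m. Poly_Mapping.lookup f m \<in> S"
  shows "Poly_Mapping.lookup (f ^ k) m \<in> S"
proof (induction k arbitrary: m)
  case 0
  then show ?case by (simp only: power_0 lookup_one when_def) (simp add: subring_setD(1,2)[OF S])
next
  case (Suc k)
  then show ?case unfolding power_Suc by (intro coeffs_mult_in_subring assms)
qed

lemma sum_fun_apply: "(\<Sum>i\<in>A. F i) x = (\<Sum>i\<in>A. F i x)" for F :: "'i \<Rightarrow> 'b \<Rightarrow> 'a :: comm_monoid_add"
  by (induction A rule: infinite_finite_induct) auto

text \<open>Evaluation of the coefficients at b is a ring homomorphism. Since p may have fewer keys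
  than f, both convolutions are summed over the keys of f and g.\<close>

lemma lookup_mult_pointwise:
  fixes f g :: "'m :: cancel_comm_monoid_add \<Rightarrow>\<^sub>0 ('b \<Rightarrow> 'a :: comm_ring_1)"
  assumes "\<And>m. Poly_Mapping.lookup f m b = Poly_Mapping.lookup p m"
    and "\<And>m. Poly_Mapping.lookup g m b = Poly_Mapping.lookup q m"
  shows "Poly_Mapping.lookup (f * g) m b = Poly_Mapping.lookup (p * q) m"
proof -
  have "Poly_Mapping.keys p \<subseteq> Poly_Mapping.keys f" "Poly_Mapping.keys q \<subseteq> Poly_Mapping.keys g"
    using assms by (auto simp: in_keys_iff) (metis zero_fun_apply)+
  then have "Poly_Mapping.lookup (p * q) m = (\<Sum>i\<in>Poly_Mapping.keys f. \<Sum>j\<in>Poly_Mapping.keys g.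
      if i + j = m then Poly_Mapping.lookup p i * Poly_Mapping.lookup q j else 0)"
    by (intro lookup_mult_sum) simp_all
  then show ?thesis
    unfolding lookup_mult_sum[OF finite_keys[of f] order_refl finite_keys[of g] order_refl]
    by (simp add: sum_fun_apply assms if_distrib[of "\<lambda>F. F b"] cong: if_cong)
qed

lemma lookup_power_pointwise:
  fixes f :: "'m :: cancel_comm_monoid_add \<Rightarrow>\<^sub>0 ('b \<Rightarrow> 'a :: comm_ring_1)"
  assumes "\<And>m. Poly_Mapping.lookup f m b = Poly_Mapping.lookup p m"
  shows "Poly_Mapping.lookup (f ^ k) m b = Poly_Mapping.lookup (p ^ k) m"
proof (induction k arbitrary: m)
  case 0
  then show ?case by (simp only: power_0 lookup_one when_def) simp
next
  case (Suc k)
  then show ?case unfolding power_Suc by (intro lookup_mult_pointwise assms)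
qed

section \<open>Rings of polynomial functions\<close>

inductive_set subring_gen :: "'a :: comm_ring_1 set \<Rightarrow> 'a set" for G where
  one: "1 \<in> subring_gen G"
| base: "g \<in> G \<Longrightarrow> g \<in> subring_gen G"
| diff: "x \<in> subring_gen G \<Longrightarrow> y \<in> subring_gen G \<Longrightarrow> x - y \<in> subring_gen G"
| mult: "x \<in> subring_gen G \<Longrightarrow> y \<in> subring_gen G \<Longrightarrow> x * y \<in> subring_gen G"

lemma subring_set_subring_gen: "subring_set (subring_gen G)"
  unfolding subring_set_def by (simp add: subring_gen.intros)

lemma subring_gen_least: "subring_set H \<Longrightarrow> G \<subseteq> H \<Longrightarrow> subring_gen G \<subseteq> H"
proof
  fix x assume "subring_set H" "G \<subseteq> H" "x \<in> subring_gen G"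
  from this(3,1,2) show "x \<in> H"
    by (induction rule: subring_gen.induct) (auto simp: subring_setD)
qed

text \<open>The polynomial functions on the image of \<open>\<pi>\<close>, as functions of the parameter.\<close>

definition coordinate_ring :: "nat \<Rightarrow> ('b \<Rightarrow> mpoly vec) \<Rightarrow> ('b \<Rightarrow> real) set" where
  "coordinate_ring k \<pi> = subring_gen
     (range (\<lambda>c _. c) \<union> {\<lambda>b. Poly_Mapping.lookup (\<pi> b $ i) m | i m. i < k})"

lemma a_inv_fun_ring:
  assumes "f \<in> carrier (fun_ring A)"
  shows "\<ominus>\<^bsub>fun_ring A\<^esub> f = (\<lambda>x\<in>A. - f x)"
proof -
  interpret cring "fun_ring A" by (rule fun_ring_cring)
  show ?thesis
    by (rule minus_equality) (use assms in \<open>auto simp: fun_ring_def fun_eq_iff\<close>)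
qed

lemma carrier_poly_fun_ring_subset: "carrier (poly_fun_ring k A) \<subseteq> extensional A"
proof -
  interpret cring "fun_ring A" by (rule fun_ring_cring)
  have "carrier (poly_fun_ring k A) \<subseteq> carrier (fun_ring A)"
    unfolding poly_fun_ring_def
    by (simp, rule generate_ring_incl) (auto simp: fun_ring_def)
  then show ?thesis by (simp add: fun_ring_def)
qed

text \<open>Composition with \<open>\<pi>\<close> respects the operations and matches generators
  with generators, so each inclusion is an induction over the generation of a ring.\<close>

lemma coordinate_ring_eq:
  "coordinate_ring k \<pi> = (\<lambda>f. f \<circ> \<pi>) ` carrier (poly_fun_ring k (range \<pi>))"
proof -
  let ?A = "range \<pi>"
  let ?H = "{\<lambda>P\<in>?A. c | c. True} \<union> {\<lambda>P\<in>?A. Poly_Mapping.lookup (P $ i) m | i m. i < k}"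
  let ?G = "generate_ring (fun_ring ?A) ?H"
  have sub: "subring_set (coordinate_ring k \<pi>)"
    unfolding coordinate_ring_def by (rule subring_set_subring_gen)
  have carr: "carrier (poly_fun_ring k ?A) = ?G" by (simp add: poly_fun_ring_def)
  have ext: "f \<in> carrier (fun_ring ?A)" if "f \<in> ?G" for f
    using carrier_poly_fun_ring_subset[of k ?A] that unfolding carr by (auto simp: fun_ring_def)
  have to: "f \<circ> \<pi> \<in> coordinate_ring k \<pi>" if "f \<in> ?G" for f
    using that
  proof (induction rule: generate_ring.induct)
    case one
    have "\<one>\<^bsub>fun_ring ?A\<^esub> \<circ> \<pi> = 1" by (simp add: fun_ring_def fun_eq_iff)
    then show ?case using subring_setD(1)[OF sub] by metis
  next
    case (incl h)
    then have "h \<circ> \<pi> \<in> range (\<lambda>c _. c) \<union> {\<lambda>b. Poly_Mapping.lookup (\<pi> b $ i) m | i m. i < k}"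
      by (elim UnE CollectE exE conjE) (auto simp: comp_def)
    then show ?case unfolding coordinate_ring_def by (rule subring_gen.base)
  next
    case (a_inv h)
    have "(\<ominus>\<^bsub>fun_ring ?A\<^esub> h) \<circ> \<pi> = - (h \<circ> \<pi>)"
      by (simp add: a_inv_fun_ring[OF ext[OF a_inv(1)]] fun_eq_iff)
    then show ?case using subring_setD(5)[OF sub a_inv(2)] by metis
  next
    case (eng_add f g)
    have "(f \<oplus>\<^bsub>fun_ring ?A\<^esub> g) \<circ> \<pi> = (f \<circ> \<pi>) + (g \<circ> \<pi>)"
      by (simp add: fun_ring_def fun_eq_iff)
    then show ?case using subring_setD(6)[OF sub eng_add(3,4)] by metis
  next
    case (eng_mult f g)
    have "(f \<otimes>\<^bsub>fun_ring ?A\<^esub> g) \<circ> \<pi> = (f \<circ> \<pi>) * (g \<circ> \<pi>)"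
      by (simp add: fun_ring_def fun_eq_iff)
    then show ?case using subring_setD(4)[OF sub eng_mult(3,4)] by metis
  qed
  have onto: "\<exists>f\<in>?G. g = f \<circ> \<pi>" if "g \<in> coordinate_ring k \<pi>" for g
    using that unfolding coordinate_ring_def
  proof (induction rule: subring_gen.induct)
    case one
    have "1 = \<one>\<^bsub>fun_ring ?A\<^esub> \<circ> \<pi>" by (simp add: fun_ring_def fun_eq_iff)
    then show ?case using generate_ring.one by blast
  next
    case (base g)
    have "\<exists>h\<in>?H. g = h \<circ> \<pi>"
    proof (cases "g \<in> range (\<lambda>c _. c)")
      case True
      then obtain c where "g = (\<lambda>_. c)" by blast
      then show ?thesis by (intro bexI[of _ "\<lambda>P\<in>?A. c"]) (auto simp: fun_eq_iff)
    next
      case False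
      then obtain i m where "g = (\<lambda>b. Poly_Mapping.lookup (\<pi> b $ i) m)" "i < k"
        using base by blast
      then show ?thesis
        by (intro bexI[of _ "\<lambda>P\<in>?A. Poly_Mapping.lookup (P $ i) m"]) (auto simp: fun_eq_iff)
    qed
    then obtain h where h: "h \<in> ?H" "g = h \<circ> \<pi>" by (rule bexE)
    show ?case by (rule bexI[where x = h]) (simp_all only: h generate_ring.incl)
  next
    case (diff x y)
    from diff.IH(1) obtain f where f: "f \<in> ?G" "x = f \<circ> \<pi>" by (rule bexE)
    from diff.IH(2) obtain g where g: "g \<in> ?G" "y = g \<circ> \<pi>" by (rule bexE)
    have "x - y = (f \<oplus>\<^bsub>fun_ring ?A\<^esub> (\<ominus>\<^bsub>fun_ring ?A\<^esub> g)) \<circ> \<pi>"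
      by (simp add: f(2) g(2) a_inv_fun_ring[OF ext[OF g(1)]]) (simp add: fun_ring_def fun_eq_iff)
    moreover have "f \<oplus>\<^bsub>fun_ring ?A\<^esub> (\<ominus>\<^bsub>fun_ring ?A\<^esub> g) \<in> ?G"
      by (intro generate_ring.eng_add generate_ring.a_inv f(1) g(1))
    ultimately show ?case by (rule bexI[where x = "f \<oplus>\<^bsub>fun_ring ?A\<^esub> (\<ominus>\<^bsub>fun_ring ?A\<^esub> g)"])
  next
    case (mult x y)
    from mult.IH(1) obtain f where f: "f \<in> ?G" "x = f \<circ> \<pi>" by (rule bexE)
    from mult.IH(2) obtain g where g: "g \<in> ?G" "y = g \<circ> \<pi>" by (rule bexE)
    have "x * y = (f \<otimes>\<^bsub>fun_ring ?A\<^esub> g) \<circ> \<pi>"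
      by (simp add: f(2) g(2) fun_ring_def fun_eq_iff)
    moreover have "f \<otimes>\<^bsub>fun_ring ?A\<^esub> g \<in> ?G"
      by (intro generate_ring.eng_mult f(1) g(1))
    ultimately show ?case by (rule bexI[where x = "f \<otimes>\<^bsub>fun_ring ?A\<^esub> g"])
  qed
  show ?thesis
    unfolding carr
  proof (intro equalityI subsetI)
    show "g \<in> (\<lambda>f. f \<circ> \<pi>) ` ?G" if "g \<in> coordinate_ring k \<pi>" for g
      using onto[OF that] by (simp only: image_iff)
    show "g \<in> coordinate_ring k \<pi>" if "g \<in> (\<lambda>f. f \<circ> \<pi>) ` ?G" for g
      using that to by (elim imageE) (simp only:)
  qed
qed

lemma krull_dim_coordinate_ring:
  "krull_dim (poly_fun_ring k (range \<pi>)) = krull_dim (ring_of (coordinate_ring k \<pi>))"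
proof (rule antisym)
  let ?A = "range \<pi>" and ?R = "poly_fun_ring k (range \<pi>)" and ?T = "coordinate_ring k \<pi>"
  have R: "cring ?R" by (rule poly_fun_ring_cring)
  have T: "cring (ring_of ?T)"
    unfolding coordinate_ring_def by (intro cring_ring_of subring_set_subring_gen)
  let ?h = "\<lambda>f. f \<circ> \<pi>"
  have "?h \<in> ring_hom ?R (ring_of ?T)"
    by (rule ring_hom_memI)
      (auto simp: ring_of_def coordinate_ring_eq, auto simp: poly_fun_ring_def fun_ring_def fun_eq_iff)
  then have "ring_hom_cring ?R (ring_of ?T) ?h"
    using R T by (simp add: ring_hom_cring_def ring_hom_cring_axioms_def)
  then show "krull_dim (ring_of ?T) \<le> krull_dim ?R"
    by (rule krull_dim_surj) (simp add: ring_of_def coordinate_ring_eq)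
  \<comment> \<open>A chosen section of \<open>\<pi>\<close> inverts the pullback, because the
    functions in question factor through \<open>\<pi>\<close>.\<close>
  let ?g = "\<lambda>f. \<lambda>P\<in>?A. f (inv_into UNIV \<pi> P)"
  have inv: "?g (f \<circ> \<pi>) = f" if "f \<in> carrier ?R" for f
    using that carrier_poly_fun_ring_subset[of k ?A]
    by (auto simp: fun_eq_iff f_inv_into_f extensional_def)
  have "?g \<in> ring_hom (ring_of ?T) ?R"
  proof (rule ring_hom_memI)
    show "?g f \<in> carrier ?R" if "f \<in> carrier (ring_of ?T)" for f
      using that inv by (auto simp: ring_of_def coordinate_ring_eq)
  qed (auto simp: ring_of_def poly_fun_ring_def fun_ring_def fun_eq_iff)
  then have "ring_hom_cring (ring_of ?T) ?R ?g"
    using R T by (simp add: ring_hom_cring_def ring_hom_cring_axioms_def)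
  then show "krull_dim ?R \<le> krull_dim (ring_of ?T)"
  proof (rule krull_dim_surj)
    have "?g ` carrier (ring_of ?T) = (\<lambda>f. ?g (f \<circ> \<pi>)) ` carrier ?R"
      by (simp add: ring_of_def coordinate_ring_eq image_image)
    also have "\<dots> = (\<lambda>f. f) ` carrier ?R" by (rule image_cong[OF refl inv])
    finally show "?g ` carrier (ring_of ?T) = carrier ?R" by simp
  qed
qed

text \<open>The coefficients of \<open>p\<close> are integral over those of \<open>p\<^sup>k\<close>, so \<open>p \<mapsto> p\<^sup>k\<close> is a finite map.\<close>

proposition semialg_dim_power_image:
  assumes fin: "finite U" and supp: "\<And>P. P \<in> X \<Longrightarrow> Poly_Mapping.keys (P $ 0) \<subseteq> U" and "k > 0"
  shows "semialg_dim 1 ((\<lambda>P. vec 1 (\<lambda>_. (P $ 0) ^ k)) ` X) = semialg_dim 1 X"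
proof (cases "X = {}")
  case False
  then obtain P0 where "P0 \<in> X" by blast
  \<comment> \<open>A retraction onto X turns the set into the range of a total function; P0 is a
    default value.\<close>
  define \<pi> where "\<pi> P = (if P \<in> X then P else P0)" for P
  define \<psi> where "\<psi> P = vec 1 (\<lambda>_. (\<pi> P $ 0) ^ k)" for P
  have range: "range \<pi> = X" "range \<psi> = (\<lambda>P. vec 1 (\<lambda>_. (P $ 0) ^ k)) ` X"
  proof -
    show X: "range \<pi> = X" using \<open>P0 \<in> X\<close> by (force simp: \<pi>_def)
    show "range \<psi> = (\<lambda>P. vec 1 (\<lambda>_. (P $ 0) ^ k)) ` X"
      unfolding \<psi>_def X[symmetric] by (simp only: image_image)
  qed
  let ?S = "coordinate_ring 1 \<pi>" and ?T = "coordinate_ring 1 \<psi>"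
  have S: "subring_set ?S" and T: "subring_set ?T"
    by (simp_all add: coordinate_ring_def subring_set_subring_gen)
  \<comment> \<open>The generic polynomial of X: its coefficients are the coordinate functions, and
    specialising at P gives the form of \<open>\<pi> P\<close>. Finiteness of \<open>U\<close> makes
    it finitely supported.\<close>
  define f where "f = (\<Sum>m\<in>U. Poly_Mapping.single m (\<lambda>P. Poly_Mapping.lookup (\<pi> P $ 0) m))"
  have lf: "Poly_Mapping.lookup f m = (\<lambda>P. Poly_Mapping.lookup (\<pi> P $ 0) m)" for m
  proof (cases "m \<in> U")
    case True
    then show ?thesis using fin by (simp add: f_def lookup_sum lookup_single when_def)
  next
    case False
    then have "Poly_Mapping.lookup (\<pi> P $ 0) m = 0" for P
      using supp[of "\<pi> P"] range(1) by (metis in_keys_iff rangeI subsetD)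
    moreover have "Poly_Mapping.lookup f m = 0"
      using False fin by (auto simp: f_def lookup_sum lookup_single when_def intro!: sum.neutral)
    ultimately show ?thesis by (simp add: fun_eq_iff)
  qed
  have lfk: "(\<lambda>P. Poly_Mapping.lookup (\<psi> P $ 0) m) = Poly_Mapping.lookup (f ^ k) m" for m
    by (rule ext) (simp add: \<psi>_def lf lookup_power_pointwise)
  have fS: "Poly_Mapping.lookup f m \<in> ?S" for m
    unfolding lf coordinate_ring_def by (intro subring_gen.base) auto
  have const: "(\<lambda>_. c) \<in> coordinate_ring 1 \<rho>" for c and \<rho> :: "mpoly vec \<Rightarrow> mpoly vec"
    unfolding coordinate_ring_def by (intro subring_gen.base) auto
  have TS: "?T \<subseteq> ?S"
    unfolding coordinate_ring_def[of 1 \<psi>]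
    by (rule subring_gen_least[OF S]) (auto simp: const lfk coeffs_power_in_subring[OF S fS] simp del: One_nat_def)
  have fT: "Poly_Mapping.lookup (f ^ k) m \<in> ?T" for m
    unfolding lfk[symmetric] coordinate_ring_def by (intro subring_gen.base) auto
  have "integral_over ?T x" if "x \<in> ?S" for x
  proof (rule integral_over_power_coeffs[OF T \<open>k > 0\<close> fT])
    fix H assume H: "subring_set H" "?T \<subseteq> H" "coeffs_of f \<subseteq> H"
    \<comment> \<open>A coordinate that vanishes identically is not among
      \<open>coeffs_of f\<close>, but it is 0 and hence in \<open>H\<close>.\<close>
    have "(\<lambda>P. Poly_Mapping.lookup (\<pi> P $ 0) m) \<in> H" for m
      unfolding lf[symmetric] using H(3) subring_setD(2)[OF H(1)]
      by (cases "m \<in> Poly_Mapping.keys f") (auto simp: in_keys_iff)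
    then have "?S \<subseteq> H"
      unfolding coordinate_ring_def[of 1 \<pi>]
      by (intro subring_gen_least[OF H(1)]) (use const[of _ \<psi>] H(2) in auto)
    then show "x \<in> H" using that by blast
  qed
  then have "krull_dim (ring_of ?T) = krull_dim (ring_of ?S)"
    by (rule krull_dim_integral_extension[OF S T TS])
  then have "semialg_dim 1 (range \<psi>) = semialg_dim 1 (range \<pi>)"
    unfolding semialg_dim_def krull_dim_coordinate_ring .
  then show ?thesis by (simp only: range)
qed simp

section \<open>Networks with a bottleneck of width one\<close>

lemma network_Cons:
  "ws \<noteq> [] \<Longrightarrow> network r (W # ws) x = network r ws (map_vec (\<lambda>t. t ^ r) (W *\<^sub>v x))"
  by (cases ws) simp_all

lemma network_append:
  "us \<noteq> [] \<Longrightarrow> vs \<noteq> []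
    \<Longrightarrow> network r (us @ vs) x = network r vs (map_vec (\<lambda>t. t ^ r) (network r us x))"
  by (induction r us x rule: network.induct) (simp_all add: network_Cons)

lemma mult_mat_vec_smult:
  fixes W :: "'a :: comm_ring_1 mat"
  assumes "dim_col W = dim_vec x"
  shows "W *\<^sub>v (c \<cdot>\<^sub>v x) = c \<cdot>\<^sub>v (W *\<^sub>v x)"
  using assms by (intro eq_vecI) (auto simp: scalar_prod_def sum_distrib_left ac_simps)

text \<open>Each activation raises the scalar to the r-th power, and the last of the layers has
  none.\<close>

lemma network_smult:
  fixes v :: "'a :: comm_ring_1 vec"
  assumes "chain_dims (dim_vec v) ws" "ws \<noteq> []"
  shows "network r ws (c \<cdot>\<^sub>v v) = c ^ (r ^ (length ws - 1)) \<cdot>\<^sub>v network r ws v"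
  using assms
proof (induction r ws v arbitrary: c rule: network.induct)
  case (2 r W x)
  then show ?case by (simp add: mult_mat_vec_smult)
next
  case (3 r W V ws x)
  have "map_vec (\<lambda>t. t ^ r) (W *\<^sub>v (c \<cdot>\<^sub>v x)) = c ^ r \<cdot>\<^sub>v map_vec (\<lambda>t. t ^ r) (W *\<^sub>v x)"
    using 3(2) mult_mat_vec_smult[of W x c]
    by (intro eq_vecI) (simp_all add: power_mult_distrib del: index_mult_mat_vec)
  then show ?case
    using 3(1)[of "c ^ r"] 3(2) by (simp flip: power_mult)
qed simp

section \<open>Splitting weight lists, and the vectors that a network can reach\<close>

lemma weights_Nil: "weights [a] = {[]}"
  by (auto simp: weights_def)

lemma Nil_weights: "[] \<in> weights (a # b # d) \<longleftrightarrow> False"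
  by (simp add: weights_def)

lemma Cons_weights: "W # ws \<in> weights (a # b # d) \<longleftrightarrow> W \<in> carrier_mat b a \<and> ws \<in> weights (b # d)"
  by (auto simp: weights_def All_less_Suc2)

lemma weights_append: "ws \<in> weights (d @ a # e)
    \<longleftrightarrow> (\<exists>us vs. ws = us @ vs \<and> us \<in> weights (d @ [a]) \<and> vs \<in> weights (a # e))"
proof (induction d arbitrary: ws)
  case Nil
  then show ?case by (simp add: weights_Nil)
next
  case (Cons b d)
  obtain c t where t: "d @ [a] = c # t" by (cases "d @ [a]") auto
  then have t': "d @ a # e = c # t @ e" by (metis append.assoc append_Cons append_Nil)
  show ?case
  proof (cases ws)
    case Nil
    then show ?thesis by (auto simp: t t' Nil_weights)
  next
    case (Cons W ws')
    have "ws \<in> weights ((b # d) @ a # e) \<longleftrightarrow> W \<in> carrier_mat c b \<and> ws' \<in> weights (d @ a # e)"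
      by (simp add: Cons t' Cons_weights)
    also have "\<dots> \<longleftrightarrow> (\<exists>us vs. ws = (W # us) @ vs \<and> W # us \<in> weights ((b # d) @ [a]) \<and> vs \<in> weights (a # e))"
      unfolding Cons.IH by (auto simp: Cons t Cons_weights)
    also have "\<dots> \<longleftrightarrow> (\<exists>us vs. ws = us @ vs \<and> us \<in> weights ((b # d) @ [a]) \<and> vs \<in> weights (a # e))"
    proof (intro iffI; elim exE conjE)
      fix us vs assume *: "ws = us @ vs" "us \<in> weights ((b # d) @ [a])" "vs \<in> weights (a # e)"
      then obtain us' where "us = W # us'"
        using Nil_weights by (cases us) (auto simp: t Cons)
      then show "\<exists>us vs. ws = (W # us) @ vs \<and> W # us \<in> weights ((b # d) @ [a]) \<and> vs \<in> weights (a # e)"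
        using * by blast
    qed blast
    finally show ?thesis .
  qed
qed

lemma network_carrier:
  assumes "ws \<in> weights (a # e @ [n])"
  shows "network r ws v \<in> carrier_vec n"
  using assms
proof (induction e arbitrary: a ws v)
  case Nil
  then obtain W where "ws = [W]" "W \<in> carrier_mat n a"
    by (cases ws) (auto simp: Nil_weights Cons_weights weights_Nil)
  then show ?case by (auto intro!: carrier_vecI)
next
  case (Cons b e)
  then obtain W ws' where ws: "ws = W # ws'" "ws' \<in> weights (b # e @ [n])"
    by (cases ws) (auto simp: Nil_weights Cons_weights)
  moreover from this have "ws' \<noteq> []" by (cases e) (auto simp: Nil_weights)
  ultimately show ?case using Cons.IH by (simp add: network_Cons)
qed

text \<open>The value 1 is passed along coordinate 0, which every layer has because widths are
  positive, and which the activation fixes because \<open>1 ^ r = 1\<close>. The last layer then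
  carries c in its first column.\<close>

lemma network_onto:
  fixes v c :: "real vec"
  assumes "\<forall>k\<in>set e. k > 0" "v \<in> carrier_vec a" "a > 0" "v $ 0 = 1" "c \<in> carrier_vec n"
  shows "\<exists>ws\<in>weights (a # e @ [n]). network r ws v = c"
  using assms(1-4)
proof (induction e arbitrary: a v)
  case Nil
  let ?W = "mat n a (\<lambda>(i, j). if j = 0 then c $ i else 0)"
  have "[?W] \<in> weights (a # [] @ [n])" by (simp add: Cons_weights weights_Nil)
  moreover have "?W *\<^sub>v v = c"
  proof (rule eq_vecI)
    fix i assume i: "i < dim_vec c"
    have "(?W *\<^sub>v v) $ i = (\<Sum>j = 0..<a. (if j = 0 then c $ i else 0) * v $ j)"
      using i assms(5) Nil by (simp add: scalar_prod_def)
    also have "\<dots> = (\<Sum>j = 0..<a. if j = 0 then c $ i else 0)"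
      using Nil by (intro sum.cong) simp_all
    finally have "(?W *\<^sub>v v) $ i = (\<Sum>j = 0..<a. if j = 0 then c $ i else 0)" .
    then show "(?W *\<^sub>v v) $ i = c $ i" using \<open>a > 0\<close> by simp
  qed (use assms(5) in auto)
  ultimately show ?case by (intro bexI[of _ "[?W]"]) simp_all
next
  case (Cons b e)
  let ?W = "mat b a (\<lambda>(i, j). if j = 0 then 1 else 0) :: real mat"
  let ?u = "map_vec (\<lambda>t. t ^ r) (?W *\<^sub>v v)"
  have b: "b > 0" "\<forall>k\<in>set e. k > 0" using Cons.prems(1) by simp_all
  have "(?W *\<^sub>v v) $ 0 = (\<Sum>j = 0..<a. (if j = 0 then 1 else 0) * v $ j)"
    using b Cons.prems by (simp add: scalar_prod_def)
  also have "\<dots> = (\<Sum>j = 0..<a. if j = 0 then 1 else 0)"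
    using Cons.prems by (intro sum.cong) simp_all
  finally have "(?W *\<^sub>v v) $ 0 = (\<Sum>j = 0..<a. if j = 0 then 1 else 0)" .
  then have "?u $ 0 = 1" using b Cons.prems(3) by simp
  moreover have "?u \<in> carrier_vec b" by (intro carrier_vecI) simp
  ultimately obtain ws where ws: "ws \<in> weights (b # e @ [n])" "network r ws ?u = c"
    using Cons.IH[of ?u b] b by blast
  then have "?W # ws \<in> weights (a # (b # e) @ [n])" by (simp add: Cons_weights)
  moreover have "ws \<noteq> []" using ws(1) by (cases e) (auto simp: Nil_weights)
  ultimately show ?case
    using ws(2) by (intro bexI[of _ "?W # ws"]) (simp_all add: network_Cons)
qed

section \<open>The layers behind a bottleneck\<close>

lemma comm_ring_hom_Const: "comm_ring_hom Const"
  by unfold_locales (simp_all add: Const_def single_add mult_single)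

lemma Const_power: "Const c ^ n = Const (c ^ n)"
  using comm_ring_hom.axioms(1)[OF comm_ring_hom_Const]
  by (induction n) (simp_all add: Const_def mult_single)

lemma chain_dims_map_mat: "chain_dims k (map (map_mat f) ws) = chain_dims k ws"
  by (induction ws arbitrary: k) auto

text \<open>The input is q times the constant vector 1. Homogeneity over the polynomial ring
  extracts q, and what remains is a network with constant input.\<close>

lemma network_scalar_input:
  assumes ws: "ws \<in> weights (1 # e @ [n])"
  shows "network r (map (map_mat Const) ws) (vec 1 (\<lambda>_. q))
    = q ^ (r ^ length e) \<cdot>\<^sub>v map_vec Const (network r ws (vec 1 (\<lambda>_. 1)))"
proof -
  have len: "length ws = Suc (length e)" using ws by (simp add: weights_def)
  have chain: "chain_dims 1 ws" using chain_dims_weights[OF ws] by simp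
  have "Const 1 = 1" by (simp add: Const_def)
  then have "vec 1 (\<lambda>_. q) = q \<cdot>\<^sub>v map_vec Const (vec 1 (\<lambda>_. 1))"
    by (intro eq_vecI) simp_all
  then have "network r (map (map_mat Const) ws) (vec 1 (\<lambda>_. q))
    = q ^ (r ^ length e) \<cdot>\<^sub>v network r (map (map_mat Const) ws) (map_vec Const (vec 1 (\<lambda>_. 1)))"
    using network_smult[of "map_vec Const (vec 1 (\<lambda>_. 1))" "map (map_mat Const) ws" r q] chain len
    by (cases ws) (simp_all add: chain_dims_map_mat del: network.simps map_vec_def)
  also have "network r (map (map_mat Const) ws) (map_vec Const (vec 1 (\<lambda>_. 1)))
      = map_vec Const (network r ws (vec 1 (\<lambda>_. 1)))"
    by (rule network_hom[symmetric, OF comm_ring_hom_Const]) (use chain in simp)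
  finally show ?thesis .
qed

lemma network_scalar_input_image:
  assumes "\<forall>k\<in>set e. k > 0"
  shows "(\<lambda>ws. network r (map (map_mat Const) ws) (vec 1 (\<lambda>_. q))) ` weights (1 # e @ [n])
    = (\<lambda>c. q ^ (r ^ length e) \<cdot>\<^sub>v map_vec Const c) ` carrier_vec n"
proof -
  have "(\<lambda>ws. network r ws (vec 1 (\<lambda>_. 1 :: real))) ` weights (1 # e @ [n]) = carrier_vec n"
  proof (intro equalityI subsetI)
    fix c :: "real vec" assume "c \<in> carrier_vec n"
    then have "\<exists>ws\<in>weights (1 # e @ [n]). network r ws (vec 1 (\<lambda>_. 1)) = c"
      by (intro network_onto assms) simp_all
    then show "c \<in> (\<lambda>ws. network r ws (vec 1 (\<lambda>_. 1))) ` weights (1 # e @ [n])" by blast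
  qed (use network_carrier in blast)
  moreover have "(\<lambda>ws. network r (map (map_mat Const) ws) (vec 1 (\<lambda>_. q))) ` weights (1 # e @ [n])
    = (\<lambda>c. q ^ (r ^ length e) \<cdot>\<^sub>v map_vec Const c)
      ` (\<lambda>ws. network r ws (vec 1 (\<lambda>_. 1))) ` weights (1 # e @ [n])"
    unfolding image_image by (rule image_cong[OF refl network_scalar_input])
  ultimately show ?thesis by (simp only:)
qed

text \<open>Without layers in front, the variable enters directly and meets no activation before the
  first weight, so the exponent is \<open>r ^ length e\<close> instead of
  \<open>r ^ Suc (length e)\<close>.\<close>

lemma neuromanifold_width_one_input:
  assumes "\<forall>k\<in>set e. k > 0"
  shows "neuromanifold (1 # e @ [n]) r = (\<lambda>c. Var 0 ^ (r ^ length e) \<cdot>\<^sub>v map_vec Const c) ` carrier_vec n"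
proof -
  have "vec 1 Var = vec 1 (\<lambda>_. Var 0)" by (intro eq_vecI) simp_all
  then show ?thesis
    using network_scalar_input_image[OF assms, of r "Var 0" n]
    by (simp add: neuromanifold_def Psi_def[abs_def])
qed

text \<open>The activation right behind the bottleneck accounts for the additional factor r in the
  exponent. The right-hand side sees \<open>e\<close> only through its length, whence the invariance
  under changing positive widths.\<close>

lemma neuromanifold_bottleneck:
  assumes "d \<noteq> []" and e: "\<forall>k\<in>set e. k > 0"
  shows "neuromanifold (d @ 1 # e @ [n]) r
    = (\<Union>P\<in>neuromanifold (d @ [1]) r.
        (\<lambda>c. (P $ 0) ^ (r ^ Suc (length e)) \<cdot>\<^sub>v map_vec Const c) ` carrier_vec n)"
proof -
  have Psi: "Psi (d @ 1 # e @ [n]) r (us @ vs)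
      = network r (map (map_mat Const) vs) (vec 1 (\<lambda>_. (Psi (d @ [1]) r us $ 0) ^ r))"
    if us: "us \<in> weights (d @ [1])" and vs: "vs \<in> weights (1 # e @ [n])" for us vs
  proof -
    have "us \<noteq> []" "vs \<noteq> []" using us vs \<open>d \<noteq> []\<close> by (auto simp: weights_def)
    moreover have "Psi (d @ [1]) r us \<in> carrier_vec 1"
      using Psi_Sym(1)[OF us] \<open>d \<noteq> []\<close> by (cases d) simp_all
    then have "map_vec (\<lambda>t. t ^ r) (Psi (d @ [1]) r us) = vec 1 (\<lambda>_. (Psi (d @ [1]) r us $ 0) ^ r)"
      by (intro eq_vecI) auto
    ultimately show ?thesis
      using \<open>d \<noteq> []\<close> by (simp add: Psi_def network_append)
  qed
  have "neuromanifold (d @ 1 # e @ [n]) r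
    = (\<Union>us\<in>weights (d @ [1]). (\<lambda>vs. Psi (d @ 1 # e @ [n]) r (us @ vs)) ` weights (1 # e @ [n]))"
    unfolding neuromanifold_def using weights_append[of _ d 1 "e @ [n]"] by (auto 0 4)
  also have "\<dots> = (\<Union>us\<in>weights (d @ [1]).
      (\<lambda>c. ((Psi (d @ [1]) r us $ 0) ^ r) ^ (r ^ length e) \<cdot>\<^sub>v map_vec Const c) ` carrier_vec n)"
  proof (rule SUP_cong[OF refl])
    fix us assume us: "us \<in> weights (d @ [1])"
    show "(\<lambda>vs. Psi (d @ 1 # e @ [n]) r (us @ vs)) ` weights (1 # e @ [n])
      = (\<lambda>c. ((Psi (d @ [1]) r us $ 0) ^ r) ^ (r ^ length e) \<cdot>\<^sub>v map_vec Const c) ` carrier_vec n"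
      unfolding network_scalar_input_image[OF e, symmetric]
      by (rule image_cong[OF refl Psi[OF us]])
  qed
  finally show ?thesis unfolding neuromanifold_def by (simp flip: power_mult)
qed

text \<open>Scaling the first weight matrix by t amounts to scaling the input, and homogeneity turns
  this into a power of t.\<close>

lemma neuromanifold_scale:
  assumes P: "P \<in> neuromanifold d r" and "length d \<ge> 2"
  shows "Const (t ^ (r ^ (length d - 2))) \<cdot>\<^sub>v P \<in> neuromanifold d r"
proof -
  obtain a b d' where d: "d = a # b # d'" using \<open>length d \<ge> 2\<close> by (metis Suc_le_length_iff numeral_2_eq_2)
  obtain ws0 where "ws0 \<in> weights d" "P = Psi d r ws0" using P unfolding neuromanifold_def by blast
  moreover from this obtain W ws where "ws0 = W # ws" by (cases ws0) (auto simp: d Nil_weights)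
  ultimately have ws: "W # ws \<in> weights d" and P: "P = Psi d r (W # ws)" by simp_all
  let ?f = "map_mat Const :: real mat \<Rightarrow> mpoly mat" and ?x = "vec a Var"
  have W: "W \<in> carrier_mat b a" and len: "length ws = length d'"
    using ws by (auto simp: d weights_def)
  have smult: "?f (t \<cdot>\<^sub>m W) *\<^sub>v ?x = ?f W *\<^sub>v (Const t \<cdot>\<^sub>v ?x)"
  proof -
    have "?f (t \<cdot>\<^sub>m W) = Const t \<cdot>\<^sub>m ?f W"
      by (intro eq_matI) (simp_all add: Const_def mult_single)
    then show ?thesis
      using W by (intro eq_vecI) (auto simp: scalar_prod_def ac_simps)
  qed
  have "Psi d r ((t \<cdot>\<^sub>m W) # ws) = network r (map ?f (W # ws)) (Const t \<cdot>\<^sub>v ?x)"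
    unfolding Psi_def by (cases ws) (simp_all add: d smult)
  also have "\<dots> = Const t ^ (r ^ length d') \<cdot>\<^sub>v P"
    using network_smult[of ?x "map ?f (W # ws)" r "Const t"] chain_dims_weights[OF ws] len
    by (simp add: P Psi_def chain_dims_map_mat d)
  finally have "Psi d r ((t \<cdot>\<^sub>m W) # ws) = Const (t ^ (r ^ (length d - 2))) \<cdot>\<^sub>v P"
    by (simp add: Const_power d)
  moreover have "(t \<cdot>\<^sub>m W) # ws \<in> weights d" using ws by (simp add: d Cons_weights)
  ultimately show ?thesis unfolding neuromanifold_def by (metis imageI)
qed

section \<open>Comparison of dimensions\<close>

lemma finite_exponents:
  "finite {m :: nat \<Rightarrow>\<^sub>0 nat. Poly_Mapping.keys m \<subseteq> {..<n} \<and> (\<Sum>i<n. Poly_Mapping.lookup m i) = D}" (is "finite ?M")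
proof (rule finite_imageD)
  show "inj_on Poly_Mapping.lookup ?M" by (intro inj_onI poly_mapping_eqI) simp
  have "Poly_Mapping.lookup ` ?M \<subseteq> {f. \<forall>i. (i \<in> {..<n} \<longrightarrow> f i \<in> {..D}) \<and> (i \<notin> {..<n} \<longrightarrow> f i = 0)}"
  proof (intro image_subsetI CollectI allI conjI impI)
    fix m i assume m: "m \<in> ?M"
    show "Poly_Mapping.lookup m i \<in> {..D}" if "i \<in> {..<n}"
      using m member_le_sum[of i "{..<n}" "Poly_Mapping.lookup m"] that by simp
    show "Poly_Mapping.lookup m i = 0" if "i \<notin> {..<n}"
      using m that by (auto simp: in_keys_iff)
  qed
  then show "finite (Poly_Mapping.lookup ` ?M)"
    by (rule finite_subset) (intro finite_set_of_finite_funs; simp)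
qed

lemma semialg_dim_neuromanifold_power:
  assumes "length d \<ge> 2" "last d = 1" "k > 0"
  shows "semialg_dim 1 ((\<lambda>P. vec 1 (\<lambda>_. (P $ 0) ^ k)) ` neuromanifold d r) = neuromanifold_dim d r"
proof -
  have "semialg_dim 1 ((\<lambda>P. vec 1 (\<lambda>_. (P $ 0) ^ k)) ` neuromanifold d r)
      = semialg_dim 1 (neuromanifold d r)"
  proof (rule semialg_dim_power_image[OF finite_exponents _ \<open>k > 0\<close>])
    fix P assume "P \<in> neuromanifold d r"
    then obtain ws where "ws \<in> weights d" "P = Psi d r ws" unfolding neuromanifold_def by blast
    then have "P $ 0 \<in> Sym (r ^ (length d - 2)) (hd d)"
      using Psi_Sym(2)[of ws d 0 r] assms by simp
    then show "Poly_Mapping.keys (P $ 0) \<subseteq> {m. Poly_Mapping.keys m \<subseteq> {..<hd d}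
        \<and> (\<Sum>i<hd d. Poly_Mapping.lookup m i) = r ^ (length d - 2)}"
      unfolding Sym_def by blast
  qed
  then show ?thesis by (simp only: neuromanifold_dim_def assms(2))
qed

text \<open>As \<open>c q\<^sup>R = \<plusminus> (\<bar>c\<bar>\<^bsup>1/R\<^esup> q)\<^sup>R\<close>, squaring removes the sign and makes both
  neuromanifolds finite covers of the same set.\<close>

lemma squares_neuromanifold_bottleneck:
  assumes "d \<noteq> []" and e: "\<forall>k\<in>set e. k > 0" and "r > 0"
  shows "(\<lambda>P. vec 1 (\<lambda>_. (P $ 0) ^ 2)) ` neuromanifold (d @ 1 # e @ [1]) r
    = (\<lambda>P. vec 1 (\<lambda>_. (P $ 0) ^ (r ^ Suc (length e) * 2))) ` neuromanifold (d @ [1]) r"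
    (is "?sq ` ?A = ?pow ` ?B")
proof -
  let ?R = "r ^ Suc (length e)"
  have len: "length (d @ [1]) \<ge> 2" using \<open>d \<noteq> []\<close> by (cases d) simp_all
  have dim: "P \<in> carrier_vec 1" if P: "P \<in> ?B" for P
  proof -
    obtain ws where "ws \<in> weights (d @ [1])" "P = Psi (d @ [1]) r ws"
      using P unfolding neuromanifold_def by blast
    then show ?thesis using Psi_Sym(1)[of ws "d @ [1]" r] len by simp
  qed
  have A: "?A = (\<Union>P\<in>?B. (\<lambda>c. (P $ 0) ^ ?R \<cdot>\<^sub>v map_vec Const c) ` carrier_vec 1)"
    by (rule neuromanifold_bottleneck[OF \<open>d \<noteq> []\<close> e])
  show ?thesis
  proof (intro equalityI image_subsetI)
    fix Q assume "Q \<in> ?A"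
    then obtain P c where P: "P \<in> ?B" and c: "c \<in> carrier_vec 1"
      and Q: "Q = (P $ 0) ^ ?R \<cdot>\<^sub>v map_vec Const c"
      unfolding A by blast
    let ?K = "r ^ (length (d @ [1]) - 2)"
    \<comment> \<open>\<open>?K\<close> is the exponent with which scaling acts on a form, and
      \<open>?R * 2\<close> the power taken afterwards. The root exists since a square is
      nonnegative and the exponent is positive.\<close>
    define t where "t = root (?K * (?R * 2)) ((c $ 0)\<^sup>2)"
    have "0 < ?K * (?R * 2)" using \<open>r > 0\<close> by simp
    then have "t ^ (?K * (?R * 2)) = (c $ 0)\<^sup>2"
      unfolding t_def by (rule real_root_pow_pos2[OF _ zero_le_power2])
    then have t: "(t ^ ?K) ^ (?R * 2) = (c $ 0)\<^sup>2" by (simp only: power_mult)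
    let ?P = "Const (t ^ ?K) \<cdot>\<^sub>v P"
    have "?P \<in> ?B" by (rule neuromanifold_scale[OF P len])
    moreover have "(?P $ 0) ^ (?R * 2) = (Q $ 0) ^ 2"
    proof -
      have "?P $ 0 = Const (t ^ ?K) * P $ 0" using dim[OF P] by simp
      then have "(?P $ 0) ^ (?R * 2) = Const ((c $ 0)\<^sup>2) * (P $ 0) ^ (?R * 2)"
        by (simp only: power_mult_distrib Const_power t)
      also have "\<dots> = ((P $ 0) ^ ?R * Const (c $ 0)) ^ 2"
        unfolding power_mult_distrib Const_power power_mult[of "P $ 0"] by (rule mult.commute)
      also have "(P $ 0) ^ ?R * Const (c $ 0) = Q $ 0" using c by (simp add: Q)
      finally show ?thesis .
    qed
    then have "?sq Q = ?pow ?P" by simp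
    ultimately show "?sq Q \<in> ?pow ` ?B" by (rule image_eqI[where x = ?P, rotated])
  next
    fix P assume P: "P \<in> ?B"
    \<comment> \<open>The constant c = 1 realises \<open>q^R\<close> itself.\<close>
    let ?Q = "(P $ 0) ^ ?R \<cdot>\<^sub>v map_vec Const (vec 1 (\<lambda>_. 1))"
    have "vec 1 (\<lambda>_. 1 :: real) \<in> carrier_vec 1" by simp
    then have "?Q \<in> ?A" unfolding A by (rule UN_I[OF P imageI])
    moreover have "?Q $ 0 = (P $ 0) ^ ?R" by (simp add: Const_def)
    then have "?pow P = ?sq ?Q" by (simp only: power_mult)
    ultimately show "?pow P \<in> ?sq ` ?A" by (rule image_eqI[where x = ?Q, rotated])
  qed
qed

theorem proposition5p4:
  fixes d0 d2 :: "nat list" and d3 r :: nat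
  assumes "\<forall>k \<in> set d0. k > 0" and "\<forall>k \<in> set d2. k > 0" and "d3 > 0" and "r > 0"
  shows "neuromanifold (d0 @ [1] @ d2 @ [d3]) r
           = neuromanifold (d0 @ [1] @ replicate (length d2) 1 @ [d3]) r
    \<and> (d0 \<noteq> [] \<longrightarrow> d3 = 1 \<longrightarrow>
         neuromanifold_dim (d0 @ [1] @ d2 @ [d3]) r = neuromanifold_dim (d0 @ [1]) r)"
proof (intro conjI impI)
  have ones: "\<forall>k\<in>set (replicate (length d2) 1). k > (0 :: nat)" by simp
  show "neuromanifold (d0 @ [1] @ d2 @ [d3]) r
      = neuromanifold (d0 @ [1] @ replicate (length d2) 1 @ [d3]) r"
  proof (cases "d0 = []")
    case True
    then show ?thesis
      using neuromanifold_width_one_input[OF assms(2)] neuromanifold_width_one_input[OF ones]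
      by simp
  next
    case False
    then show ?thesis
      using neuromanifold_bottleneck[OF False assms(2)] neuromanifold_bottleneck[OF False ones]
      by simp
  qed
  assume d0: "d0 \<noteq> []" and "d3 = 1"
  have len: "length (d0 @ [1]) \<ge> 2" "length (d0 @ 1 # d2 @ [1]) \<ge> 2"
    using d0 by (cases d0; simp)+
  \<comment> \<open>Both sides have the dimension of the common image, reached by exponent 2 from
    the long network and by 2R from the short one.\<close>
  have "neuromanifold_dim (d0 @ 1 # d2 @ [1]) r
      = semialg_dim 1 ((\<lambda>P. vec 1 (\<lambda>_. (P $ 0) ^ 2)) ` neuromanifold (d0 @ 1 # d2 @ [1]) r)"
    by (rule semialg_dim_neuromanifold_power[symmetric, OF len(2)]) simp_all
  also have "\<dots> = semialg_dim 1 ((\<lambda>P. vec 1 (\<lambda>_. (P $ 0) ^ (r ^ Suc (length d2) * 2)))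
      ` neuromanifold (d0 @ [1]) r)"
    by (simp only: squares_neuromanifold_bottleneck[OF d0 assms(2,4)])
  also have "\<dots> = neuromanifold_dim (d0 @ [1]) r"
    by (rule semialg_dim_neuromanifold_power[OF len(1)]) (use assms(4) in simp_all)
  finally show "neuromanifold_dim (d0 @ [1] @ d2 @ [d3]) r = neuromanifold_dim (d0 @ [1]) r"
    using \<open>d3 = 1\<close> by simp
qed

end
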